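(* Let $(E,\|\cdot\|_E)$ be a Banach space of martingale type 2. Then there exists a constant $M(E)\in(0,\infty)$ such that for any $n\in\mathbb{N}$ with $n\geq2$, every function $f:\mathscr{S}_n\to E$ satisfies $$\big\|f-\mathbb{E}f\big\|_{L_2(\log L)(E)}^2\leq\frac{M(E)\log n}{n-1}\sum_{\tau\in\mathscr{T}_n}\int_{\mathscr{S}_n}\big\|f(\pi)-f(\tau\circ\pi)\big\|_E^2\,d\nu_n(\pi).$$
   Context: $\mathscr{S}_n$ is the symmetric group on $n$ elements, $\nu_n$ is the uniform probability measure on $\mathscr{S}_n$, and $\mathscr{T}_n\subseteq\mathscr{S}_n$ is the set of all transpositions. $\mathbb{E}f=\int f\,d\nu_n$. For $g:\mathscr{S}_n\to E$, $\|g\|_{L_2(\log L)(E)}=\inf\{\gamma>0:\int\psi(\|g\|_E/\gamma)\,d\nu_n\leq1\}$ with $\psi(t)=t^2\log(e+t^2)$. A normed space $E$ has martingale type 2 if there is $M\in(0,\infty)$ such that for any $n\in\mathbb{N}$, any probability space $(\Omega,\mathscr{F},\mu)$ and any filtration $\{\mathscr{F}_i\}_{i=0}^n$ of sub-$\sigma$-algebras of $\mathscr{F}$, every $E$-valued martingale $\{\mathscr{M}_i:\Omega\to E\}_{i=0}^n$ adapted to $\{\mathscr{F}_i\}_{i=0}^n$ satisfies $\|\mathscr{M}_n-\mathscr{M}_0\|_{L_2(\mu;E)}^2\leq M^2\sum_{i=1}^n\|\mathscr{M}_i-\mathscr{M}_{i-1}\|_{L_2(\mu;E)}^2$. *)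

theory Defs
  imports "HOL-Probability.Probability" "HOL-Combinatorics.Permutations"
begin

section \<open>The Bochner integral without a separability assumption\<close>

text \<open>
  The Bochner integral of HOL-Analysis is only available for second-countable target
  types. The definitions below follow it literally, except that \<open>borel_measurable\<close> is replaced by
  strong measurability (Borel measurability together with a separable range, which is automatic
  in a second-countable target), so that arbitrary Banach spaces are covered.
\<close>

definition strongly_measurable :: "'a measure \<Rightarrow> ('a \<Rightarrow> 'e::banach) \<Rightarrow> bool" where
  "strongly_measurable M f \<longleftrightarrow>
     f \<in> borel_measurable M \<and> (\<exists>D. countable D \<and> f ` space M \<subseteq> closure D)"

definition has_lint :: "'a measure \<Rightarrow> ('a \<Rightarrow> 'e::banach) \<Rightarrow> 'e \<Rightarrow> bool" where
  "has_lint M f x \<longleftrightarrow>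
     strongly_measurable M f \<and>
     (\<exists>s. (\<forall>i. Bochner_Integration.simple_bochner_integrable M (s i)) \<and>
          (\<lambda>i. \<integral>\<^sup>+ \<omega>. ennreal (norm (f \<omega> - s i \<omega>)) \<partial>M) \<longlonglongrightarrow> 0 \<and>
          (\<lambda>i. Bochner_Integration.simple_bochner_integral M (s i)) \<longlonglongrightarrow> x)"

definition lint_integrable :: "'a measure \<Rightarrow> ('a \<Rightarrow> 'e::banach) \<Rightarrow> bool" where
  "lint_integrable M f \<longleftrightarrow> (\<exists>x. has_lint M f x)"

definition lint :: "'a measure \<Rightarrow> ('a \<Rightarrow> 'e::banach) \<Rightarrow> 'e" where
  "lint M f = (THE x. has_lint M f x)"


section \<open>Martingale type 2\<close>

text \<open>
  Only the \<sigma>-algebra of each \<open>F i\<close> matters. The last clause says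
  that \<open>X i\<close> is the conditional expectation of \<open>X (Suc i)\<close> given \<open>F i\<close>.
\<close>

definition martingale_upto ::
  "nat \<Rightarrow> 'w measure \<Rightarrow> (nat \<Rightarrow> 'w measure) \<Rightarrow> (nat \<Rightarrow> 'w \<Rightarrow> 'e::banach) \<Rightarrow> bool" where
  "martingale_upto n \<mu> F X \<longleftrightarrow>
     (\<forall>i\<le>n. subalgebra \<mu> (F i)) \<and>
     (\<forall>i j. i \<le> j \<and> j \<le> n \<longrightarrow> subalgebra (F j) (F i)) \<and>
     (\<forall>i\<le>n. strongly_measurable (F i) (X i) \<and> lint_integrable \<mu> (X i)) \<and>
     (\<forall>i<n. \<forall>A\<in>sets (F i).
        lint \<mu> (\<lambda>\<omega>. indicator A \<omega> *\<^sub>R X (Suc i) \<omega>) = lint \<mu> (\<lambda>\<omega>. indicator A \<omega> *\<^sub>R X i \<omega>))"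

text \<open>
  The inequality is between extended nonnegative numbers, so the martingales are not assumed to
  be square integrable.
\<close>

definition martingale_type_2_bound :: "real \<Rightarrow> 'w itself \<Rightarrow> 'e::banach itself \<Rightarrow> bool" where
  "martingale_type_2_bound C W E \<longleftrightarrow>
     (\<forall>(n::nat) (\<mu>::'w measure) F (X::nat \<Rightarrow> 'w \<Rightarrow> 'e).
        prob_space \<mu> \<and> martingale_upto n \<mu> F X \<longrightarrow>
        (\<integral>\<^sup>+ \<omega>. ennreal ((norm (X n \<omega> - X 0 \<omega>))\<^sup>2) \<partial>\<mu>)
          \<le> ennreal (C\<^sup>2) * (\<Sum>i=1..n. \<integral>\<^sup>+ \<omega>. ennreal ((norm (X i \<omega> - X (i - 1) \<omega>))\<^sup>2) \<partial>\<mu>))"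

text \<open>
  HOL cannot quantify over the type of the sample points inside a formula. Taking them in the path
  space \<open>nat \<Rightarrow> 'e\<close> loses nothing: lemma \<open>martingale_type_2_bound_any_space\<close> below
  shows that the inequality, with the same constant, then holds on probability spaces over
  every type.
\<close>

definition martingale_type_2 :: "'e::banach itself \<Rightarrow> bool" where
  "martingale_type_2 E \<longleftrightarrow> (\<exists>C>0. martingale_type_2_bound C TYPE(nat \<Rightarrow> 'e) E)"


section \<open>The symmetric group\<close>

abbreviation sym_group :: "nat \<Rightarrow> (nat \<Rightarrow> nat) set" where
  "sym_group n \<equiv> {\<pi>. \<pi> permutes {1..n}}"

definition unif_sym :: "nat \<Rightarrow> (nat \<Rightarrow> nat) measure" where
  "unif_sym n = uniform_count_measure (sym_group n)"

definition transpositions :: "nat \<Rightarrow> (nat \<Rightarrow> nat) set" where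
  "transpositions n =
     {Transposition.transpose a b |a b. a \<in> {1..n} \<and> b \<in> {1..n} \<and> a \<noteq> b}"

definition psi :: "real \<Rightarrow> real" where
  "psi t = t\<^sup>2 * ln (exp 1 + t\<^sup>2)"

definition L2logL_norm :: "nat \<Rightarrow> ((nat \<Rightarrow> nat) \<Rightarrow> 'e::banach) \<Rightarrow> real" where
  "L2logL_norm n g = Inf {\<gamma>. \<gamma> > 0 \<and> (\<integral>\<pi>. psi (norm (g \<pi>) / \<gamma>) \<partial>unif_sym n) \<le> 1}"


section \<open>Basic properties of the integral\<close>

lemma measurable_norm_diff_simple:
  fixes f s :: "'a \<Rightarrow> 'e::banach"
  assumes f: "f \<in> borel_measurable M" and s: "simple_function M s"
  shows "(\<lambda>x. norm (f x - s x)) \<in> borel_measurable M"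
proof (rule measurable_compose_countable'[where I="s ` space M" and g=s and f="\<lambda>y x. norm (f x - y)"])
  show "(\<lambda>x. norm (f x - y)) \<in> borel_measurable M" for y
    by (rule borel_measurable_continuous_on[OF _ f]) (intro continuous_intros)
  show "s \<in> measurable M (count_space (s ` space M))"
    using measurable_simple_function[OF s] by (auto simp: measurable_count_space_eq2_countable
      intro!: measurable_count_space_extend measurableI simple_functionD(2)[OF s])
  show "countable (s ` space M)"
    using simple_functionD(1)[OF s] by (rule countable_finite)
qed

lemma measurable_norm_diff:
  fixes f g :: "'a \<Rightarrow> 'e::banach"
  assumes f: "strongly_measurable M f" and g: "strongly_measurable M g"
  shows "(\<lambda>x. ennreal (norm (f x - g x))) \<in> borel_measurable M"
proof -
  obtain D where D: "countable D" "f ` space M \<subseteq> closure D"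
    using f by (auto simp: strongly_measurable_def)
  have m: "(\<lambda>x. norm (h x - d)) \<in> borel_measurable M" if "h \<in> borel_measurable M" for d and h :: "'a \<Rightarrow> 'e"
    by (rule borel_measurable_continuous_on[OF _ that]) (intro continuous_intros)
  have [measurable]: "f \<in> borel_measurable M" "g \<in> borel_measurable M"
    using f g by (auto simp: strongly_measurable_def)
  have "(\<lambda>x. INF d\<in>D. ennreal (norm (f x - d) + norm (g x - d))) \<in> borel_measurable M"
    using D(1) by (intro borel_measurable_INF measurable_compose[OF _ measurable_ennreal]
      borel_measurable_add m) auto
  moreover have "(INF d\<in>D. ennreal (norm (f x - d) + norm (g x - d))) = ennreal (norm (f x - g x))"
    if x: "x \<in> space M" for x
  proof (rule antisym)
    show "ennreal (norm (f x - g x)) \<le> (INF d\<in>D. ennreal (norm (f x - d) + norm (g x - d)))"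
      by (intro INF_greatest ennreal_leI) (metis dist_commute dist_norm dist_triangle)
    show "(INF d\<in>D. ennreal (norm (f x - d) + norm (g x - d))) \<le> ennreal (norm (f x - g x))"
    proof (rule ennreal_le_epsilon)
      fix e :: real assume e: "0 < e"
      obtain d where d: "d \<in> D" "dist d (f x) < e / 2"
        using D(2) x e closure_approachable[of "f x" D] by (metis half_gt_zero image_subset_iff)
      have "norm (g x - d) \<le> norm (g x - f x) + norm (f x - d)"
        by (metis dist_norm dist_triangle)
      then have *: "norm (f x - d) + norm (g x - d) \<le> norm (f x - g x) + e"
        using d(2) by (simp add: dist_norm norm_minus_commute)
      have "(INF d\<in>D. ennreal (norm (f x - d) + norm (g x - d))) \<le> ennreal (norm (f x - d) + norm (g x - d))"
        using d(1) by (rule INF_lower)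
      also have "\<dots> \<le> ennreal (norm (f x - g x) + e)"
        using * by (rule ennreal_leI)
      finally show "(INF d\<in>D. ennreal (norm (f x - d) + norm (g x - d))) \<le> ennreal (norm (f x - g x)) + ennreal e"
        using e by simp
    qed
  qed
  ultimately show ?thesis
    by (simp cong: measurable_cong)
qed

lemma simple_bochner_integral_bounded':
  fixes f :: "'a \<Rightarrow> 'e::banach"
  assumes f: "f \<in> borel_measurable M"
  assumes s: "Bochner_Integration.simple_bochner_integrable M s" and t: "Bochner_Integration.simple_bochner_integrable M t"
  shows "ennreal (norm (Bochner_Integration.simple_bochner_integral M s - Bochner_Integration.simple_bochner_integral M t)) \<le>
    (\<integral>\<^sup>+ x. norm (f x - s x) \<partial>M) + (\<integral>\<^sup>+ x. norm (f x - t x) \<partial>M)"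
    (is "ennreal (norm (?s - ?t)) \<le> ?S + ?T")
proof -
  have sf: "simple_function M s" "simple_function M t"
    using s t by (auto elim: simple_bochner_integrable.cases)
  have "ennreal (norm (?s - ?t)) = norm (Bochner_Integration.simple_bochner_integral M (\<lambda>x. s x - t x))"
    using s t by (subst simple_bochner_integral_diff) auto
  also have "\<dots> \<le> Bochner_Integration.simple_bochner_integral M (\<lambda>x. norm (s x - t x))"
    using simple_bochner_integrable_compose2[of "(-)" M "s" "t"] s t
    by (auto intro!: simple_bochner_integral_norm_bound)
  also have "\<dots> = (\<integral>\<^sup>+x. norm (s x - t x) \<partial>M)"
    using simple_bochner_integrable_compose2[of "\<lambda>x y. norm (x - y)" M "s" "t"] s t
    by (auto intro!: simple_bochner_integral_eq_nn_integral)
  also have "\<dots> \<le> (\<integral>\<^sup>+x. ennreal (norm (f x - s x)) + ennreal (norm (f x - t x)) \<partial>M)"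
  proof -
    have "\<And>x. x \<in> space M \<Longrightarrow>
         norm (s x - t x) \<le> norm (f x - s x) + norm (f x - t x)"
      by (metis dual_order.refl norm_diff_triangle_le norm_minus_commute)
    then show ?thesis
      by (metis (mono_tags, lifting) ennreal_leI ennreal_plus nn_integral_mono norm_ge_zero)
  qed
  also have "\<dots> = ?S + ?T"
    using measurable_norm_diff_simple[OF f sf(1)] measurable_norm_diff_simple[OF f sf(2)]
    by (intro nn_integral_add) auto
  finally show ?thesis .
qed

lemma has_lint_unique:
  assumes "has_lint M f x" "has_lint M f y"
  shows "x = y"
proof -
  obtain s where s: "\<And>i. Bochner_Integration.simple_bochner_integrable M (s i)"
    "(\<lambda>i. \<integral>\<^sup>+ \<omega>. ennreal (norm (f \<omega> - s i \<omega>)) \<partial>M) \<longlonglongrightarrow> 0" (is "?S \<longlonglongrightarrow> 0")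
    "(\<lambda>i. Bochner_Integration.simple_bochner_integral M (s i)) \<longlonglongrightarrow> x"
    using assms(1) by (auto simp: has_lint_def)
  obtain t where t: "\<And>i. Bochner_Integration.simple_bochner_integrable M (t i)"
    "(\<lambda>i. \<integral>\<^sup>+ \<omega>. ennreal (norm (f \<omega> - t i \<omega>)) \<partial>M) \<longlonglongrightarrow> 0" (is "?T \<longlonglongrightarrow> 0")
    "(\<lambda>i. Bochner_Integration.simple_bochner_integral M (t i)) \<longlonglongrightarrow> y"
    using assms(2) by (auto simp: has_lint_def)
  have f: "f \<in> borel_measurable M"
    using assms(1) by (auto simp: has_lint_def strongly_measurable_def)
  have "(\<lambda>i. ennreal (norm (Bochner_Integration.simple_bochner_integral M (s i) - Bochner_Integration.simple_bochner_integral M (t i))))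
      \<longlonglongrightarrow> ennreal (norm (x - y))"
    by (intro tendsto_intros s t)
  moreover have "(\<lambda>i. ennreal (norm (Bochner_Integration.simple_bochner_integral M (s i) - Bochner_Integration.simple_bochner_integral M (t i)))) \<longlonglongrightarrow> 0"
  proof (rule tendsto_sandwich[OF _ _ tendsto_const])
    show "(\<lambda>i. ?S i + ?T i) \<longlonglongrightarrow> 0"
      using tendsto_add[OF s(2) t(2)] by simp
    show "\<forall>\<^sub>F i in sequentially. ennreal (norm (Bochner_Integration.simple_bochner_integral M (s i) - Bochner_Integration.simple_bochner_integral M (t i))) \<le> ?S i + ?T i"
      by (intro always_eventually allI simple_bochner_integral_bounded' f s t)
  qed auto
  ultimately have "ennreal (norm (x - y)) = 0"
    by (rule LIMSEQ_unique)
  then show ?thesis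
    by simp
qed

lemma lint_eq: "has_lint M f x \<Longrightarrow> lint M f = x"
  unfolding lint_def by (blast intro: has_lint_unique)

lemma strongly_measurable_cong:
  "(\<And>x. x \<in> space M \<Longrightarrow> f x = g x) \<Longrightarrow> strongly_measurable M f \<longleftrightarrow> strongly_measurable M g"
  unfolding strongly_measurable_def by (simp cong: measurable_cong image_cong)

lemma has_lint_cong:
  "(\<And>x. x \<in> space M \<Longrightarrow> f x = g x) \<Longrightarrow> has_lint M f x \<longleftrightarrow> has_lint M g x"
  unfolding has_lint_def by (simp cong: strongly_measurable_cong nn_integral_cong)

lemma lint_cong:
  "(\<And>x. x \<in> space M \<Longrightarrow> f x = g x) \<Longrightarrow> lint M f = lint M g"
  unfolding lint_def using has_lint_cong[of M f g] by presburger

lemma strongly_measurable_indicator: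
  assumes A: "A \<in> sets M" and f: "strongly_measurable M f"
  shows "strongly_measurable M (\<lambda>x. indicator A x *\<^sub>R f x)"
proof -
  obtain D where D: "countable D" "f ` space M \<subseteq> closure D" and m: "f \<in> borel_measurable M"
    using f by (auto simp: strongly_measurable_def)
  have "(\<lambda>x. if x \<in> A then f x else 0) \<in> borel_measurable M"
    using A m by (intro measurable_If_set) auto
  also have "(\<lambda>x. if x \<in> A then f x else 0) = (\<lambda>x. indicator A x *\<^sub>R f x)"
    by (auto simp: indicator_def)
  finally have 1: "(\<lambda>x. indicator A x *\<^sub>R f x) \<in> borel_measurable M" .
  have "(\<lambda>x. indicator A x *\<^sub>R f x) ` space M \<subseteq> insert 0 (f ` space M)"
    by (auto simp: indicator_def)
  also have "\<dots> \<subseteq> closure (insert 0 D)"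
    using D(2) closure_subset[of "insert 0 D"] closure_mono[of D "insert 0 D"] by blast
  finally show ?thesis
    using 1 D(1) unfolding strongly_measurable_def by (meson countable_insert)
qed

lemma has_lint_simple:
  assumes "Bochner_Integration.simple_bochner_integrable M f"
  shows "has_lint M f (Bochner_Integration.simple_bochner_integral M f)"
proof -
  have s: "simple_function M f"
    using assms by (auto elim: simple_bochner_integrable.cases)
  have "strongly_measurable M f"
    unfolding strongly_measurable_def
  proof (intro conjI exI)
    show "f \<in> borel_measurable M"
      by (rule borel_measurable_simple_function[OF s])
    show "countable (f ` space M)"
      by (rule countable_finite[OF simple_functionD(1)[OF s]])
    show "f ` space M \<subseteq> closure (f ` space M)"
      by (rule closure_subset)
  qed
  then show ?thesis
    unfolding has_lint_def using assms by (auto intro!: exI[of _ "\<lambda>_. f"] simp flip: zero_ennreal_def)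
qed

lemma lint_integrableD_finite:
  assumes "lint_integrable M f"
  shows "(\<integral>\<^sup>+ x. ennreal (norm (f x)) \<partial>M) < \<infinity>"
proof -
  obtain s where s: "\<And>i. Bochner_Integration.simple_bochner_integrable M (s i)"
    "(\<lambda>i. \<integral>\<^sup>+ \<omega>. ennreal (norm (f \<omega> - s i \<omega>)) \<partial>M) \<longlonglongrightarrow> 0"
    and f: "f \<in> borel_measurable M"
    using assms by (auto simp: lint_integrable_def has_lint_def strongly_measurable_def)
  have "\<forall>\<^sub>F i in sequentially. (\<integral>\<^sup>+ \<omega>. ennreal (norm (f \<omega> - s i \<omega>)) \<partial>M) < 1"
    using order_tendstoD(2)[OF s(2), of 1] by simp
  then obtain i where i: "(\<integral>\<^sup>+ \<omega>. ennreal (norm (f \<omega> - s i \<omega>)) \<partial>M) < 1"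
    by (auto simp: eventually_sequentially)
  have sf: "simple_function M (s i)"
    using s(1)[of i] by (auto elim: simple_bochner_integrable.cases)
  have sn: "Bochner_Integration.simple_bochner_integrable M (\<lambda>x. norm (s i x))"
    using simple_bochner_integrable_compose2[of "\<lambda>x y. norm x" M "s i" "s i"] s(1) by auto
  have "(\<integral>\<^sup>+ x. ennreal (norm (f x)) \<partial>M)
      \<le> (\<integral>\<^sup>+ x. ennreal (norm (f x - s i x)) + ennreal (norm (s i x)) \<partial>M)"
    by (intro nn_integral_mono) (metis ennreal_leI ennreal_plus norm_ge_zero norm_triangle_sub add.commute)
  also have "\<dots> = (\<integral>\<^sup>+ x. ennreal (norm (f x - s i x)) \<partial>M) + (\<integral>\<^sup>+ x. ennreal (norm (s i x)) \<partial>M)"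
    using measurable_norm_diff_simple[OF f sf] borel_measurable_simple_function[of M "\<lambda>x. norm (s i x)"] sn
    by (intro nn_integral_add) (auto elim: simple_bochner_integrable.cases)
  also have "\<dots> < \<infinity>"
    using order.strict_trans[OF i, of top] simple_bochner_integral_eq_nn_integral[OF sn, symmetric]
    by (simp add: less_top[symmetric])
  finally show ?thesis .
qed

lemma lint_integrableI_finite:
  fixes f :: "'a \<Rightarrow> 'e::banach"
  assumes fin: "finite_measure M" and f: "strongly_measurable M f"
    and nf: "(\<integral>\<^sup>+ x. ennreal (norm (f x)) \<partial>M) < \<infinity>"
  shows "lint_integrable M f"
proof -
  interpret finite_measure M by fact
  obtain D where D: "countable D" "f ` space M \<subseteq> closure D" and m: "f \<in> borel_measurable M"
    using f by (auto simp: strongly_measurable_def)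
  have mn: "(\<lambda>x. norm (f x - d)) \<in> borel_measurable M" for d
    by (rule borel_measurable_continuous_on[OF _ m]) (intro continuous_intros)
  have mn0[measurable]: "(\<lambda>x. norm (f x)) \<in> borel_measurable M"
    using mn[of 0] by simp
  have approx: "\<exists>s. Bochner_Integration.simple_bochner_integrable M s \<and> (\<integral>\<^sup>+ x. ennreal (norm (f x - s x)) \<partial>M) \<le> ennreal e * (emeasure M (space M) + 1)"
    if e: "e > 0" for e
  proof (cases "space M = {}")
    case True
    then show ?thesis
      by (intro exI[of _ "\<lambda>_. 0"]) (auto simp: simple_bochner_integrable.simps nn_integral_empty)
  next
    case False
    then have "D \<noteq> {}" using D(2) by auto
    define d where "d = from_nat_into D"
    have dD: "range d = D"
      using D(1) \<open>D \<noteq> {}\<close> by (simp add: d_def range_from_nat_into)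
    define A where "A i = {x \<in> space M. norm (f x - d i) < e}" for i
    define B where "B = disjointed A"
    have A[measurable]: "A i \<in> sets M" for i
      unfolding A_def using mn[of "d i"] by measurable
    have B[measurable]: "B i \<in> sets M" for i
      using sets.range_disjointed_sets[of A M] A unfolding B_def by blast
    have BA: "B i \<subseteq> A i" for i
      by (simp add: B_def disjointed_subset)
    have "space M \<subseteq> (\<Union>i. A i)"
    proof
      fix x assume x: "x \<in> space M"
      obtain y where "y \<in> D" "dist y (f x) < e"
        using D(2) x e closure_approachable[of "f x" D] by (metis image_subset_iff)
      moreover then obtain i where "y = d i"
        using dD by auto
      ultimately show "x \<in> (\<Union>i. A i)"
        using x by (auto simp: A_def dist_norm norm_minus_commute)
    qed
    then have UB: "(\<Union>i. B i) = space M"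
      unfolding B_def UN_disjointed_eq by (auto simp: A_def)
    define R where "R N = space M - (\<Union>i<N. B i)" for N :: nat
    have R[measurable]: "R N \<in> sets M" for N
      by (auto simp: R_def)
    have "(\<lambda>N. \<integral>\<^sup>+ x. ennreal (norm (f x)) * indicator (R N) x \<partial>M) \<longlonglongrightarrow> (\<integral>\<^sup>+ x. 0 \<partial>M)"
    proof (rule nn_integral_dominated_convergence[where w="\<lambda>x. ennreal (norm (f x))"])
      show "AE x in M. (\<lambda>N. ennreal (norm (f x)) * indicator (R N) x) \<longlonglongrightarrow> 0"
      proof (rule AE_I2)
        fix x assume "x \<in> space M"
        then obtain i where i: "x \<in> B i" using UB by auto
        have "\<forall>\<^sub>F N in sequentially. ennreal (norm (f x)) * indicator (R N) x = 0"
          using eventually_gt_at_top[of i] by eventually_elim (use i in \<open>auto simp: R_def indicator_def\<close>)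
        then show "(\<lambda>N. ennreal (norm (f x)) * indicator (R N) x) \<longlonglongrightarrow> 0"
          by (rule tendsto_eventually)
      qed
    qed (use nf in \<open>auto simp: indicator_def\<close>)
    then have "\<forall>\<^sub>F N in sequentially. (\<integral>\<^sup>+ x. ennreal (norm (f x)) * indicator (R N) x \<partial>M) < ennreal e"
      using e by (intro order_tendstoD(2)[of _ 0]) auto
    then obtain N where N: "(\<integral>\<^sup>+ x. ennreal (norm (f x)) * indicator (R N) x \<partial>M) < ennreal e"
      by (auto simp: eventually_sequentially)
    define s where "s x = (\<Sum>i<N. indicator (B i) x *\<^sub>R d i)" for x
    have simp_ind: "simple_function M (\<lambda>x. indicator (B i) x *\<^sub>R d i)" for i
      using simple_function_compose1[OF simple_function_indicator[OF B[of i]], of "\<lambda>r::real. r *\<^sub>R d i"] by simp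
    have ss: "simple_function M (\<lambda>x. \<Sum>i<k. indicator (B i) x *\<^sub>R d i)" for k :: nat
    proof (induction k)
      case (Suc k)
      show ?case
        using simple_function_compose2[OF Suc simp_ind[of k], of "(+)"] by simp
    qed simp
    have sf: "simple_function M s"
      unfolding s_def by (rule ss)
    have sbi: "Bochner_Integration.simple_bochner_integrable M s"
      using sf by (auto simp: simple_bochner_integrable.simps)
    have disj: "disjoint_family B"
      unfolding B_def by (rule disjoint_family_disjointed)
    have sB: "s x = d j" if "x \<in> B j" "j < N" for x j
    proof -
      have "indicator (B i) x *\<^sub>R d i = (if i = j then d j else 0)" for i
        using that disj by (auto simp: disjoint_family_on_def indicator_def)
      then show ?thesis
        using that by (simp add: s_def)
    qed
    have "(\<integral>\<^sup>+ x. ennreal (norm (f x - s x)) \<partial>M)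
        \<le> (\<integral>\<^sup>+ x. ennreal e + ennreal (norm (f x)) * indicator (R N) x \<partial>M)"
    proof (rule nn_integral_mono)
      fix x assume x: "x \<in> space M"
      show "ennreal (norm (f x - s x)) \<le> ennreal e + ennreal (norm (f x)) * indicator (R N) x"
      proof (cases "x \<in> R N")
        case True
        then have "s x = 0"
          by (auto simp: s_def R_def indicator_def intro!: sum.neutral)
        then show ?thesis using True by simp
      next
        case False
        then obtain j where j: "j < N" "x \<in> B j" using x by (auto simp: R_def)
        then have "norm (f x - s x) < e"
          using sB[OF j(2,1)] BA[of j] by (auto simp: A_def)
        then show ?thesis using False by (simp add: ennreal_leI)
      qed
    qed
    also have "\<dots> = ennreal e * emeasure M (space M) + (\<integral>\<^sup>+ x. ennreal (norm (f x)) * indicator (R N) x \<partial>M)"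
      by (subst nn_integral_add) auto
    also have "\<dots> \<le> ennreal e * emeasure M (space M) + ennreal e"
      using N by (intro add_left_mono) simp
    finally show ?thesis
      using sbi by (auto simp: distrib_left)
  qed
  have "\<exists>s. \<forall>i. Bochner_Integration.simple_bochner_integrable M (s i) \<and>
      (\<integral>\<^sup>+ x. ennreal (norm (f x - s i x)) \<partial>M) \<le> ennreal (1 / Suc i) * (emeasure M (space M) + 1)"
    by (intro choice allI approx) simp
  then obtain s where s: "\<And>i. Bochner_Integration.simple_bochner_integrable M (s i)"
    and le: "\<And>i. (\<integral>\<^sup>+ x. ennreal (norm (f x - s i x)) \<partial>M) \<le> ennreal (1 / Suc i) * (emeasure M (space M) + 1)"
    by auto
  define K where "K = measure M (space M) + 1"
  have K: "emeasure M (space M) + 1 = ennreal K" "K > 0"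
    by (auto simp: K_def emeasure_eq_measure add_nonneg_pos ennreal_plus simp flip: ennreal_1)
  have le': "(\<integral>\<^sup>+ x. ennreal (norm (f x - s i x)) \<partial>M) \<le> ennreal (K / Suc i)" for i
    using le[of i] K by (simp add: ennreal_mult[symmetric])
  have lim: "(\<lambda>i. ennreal (K / Suc i)) \<longlonglongrightarrow> 0"
    using tendsto_ennrealI[OF LIMSEQ_Suc[OF lim_const_over_n[of K]]] by simp
  have 1: "(\<lambda>i. \<integral>\<^sup>+ x. ennreal (norm (f x - s i x)) \<partial>M) \<longlonglongrightarrow> 0"
    by (rule tendsto_sandwich[OF _ _ tendsto_const lim]) (use le' in auto)
  have "Cauchy (\<lambda>i. Bochner_Integration.simple_bochner_integral M (s i))"
  proof (rule metric_CauchyI)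
    fix e :: real assume e: "e > 0"
    obtain k :: nat where k: "2 * K / e < real k"
      using reals_Archimedean2 by blast
    show "\<exists>k. \<forall>i\<ge>k. \<forall>j\<ge>k. dist (Bochner_Integration.simple_bochner_integral M (s i)) (Bochner_Integration.simple_bochner_integral M (s j)) < e"
    proof (intro exI[of _ k] allI impI)
      fix i j assume ij: "k \<le> i" "k \<le> j"
      have small: "K / real (Suc l) < e / 2" if "k \<le> l" for l
      proof -
        have "2 * K / e < real (Suc l)" using k that by linarith
        then show ?thesis using e by (simp add: field_simps)
      qed
      have "ennreal (dist (Bochner_Integration.simple_bochner_integral M (s i)) (Bochner_Integration.simple_bochner_integral M (s j)))
          \<le> ennreal (K / Suc i) + ennreal (K / Suc j)"
        unfolding dist_norm
        using simple_bochner_integral_bounded'[OF m s[of i] s[of j]] le'[of i] le'[of j]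
        by (meson add_mono order_trans)
      also have "\<dots> = ennreal (K / Suc i + K / Suc j)"
        using K by (simp add: ennreal_plus)
      finally have "dist (Bochner_Integration.simple_bochner_integral M (s i)) (Bochner_Integration.simple_bochner_integral M (s j)) \<le> K / Suc i + K / Suc j"
        using K by (subst (asm) ennreal_le_iff) auto
      then show "dist (Bochner_Integration.simple_bochner_integral M (s i)) (Bochner_Integration.simple_bochner_integral M (s j)) < e"
        using small[OF ij(1)] small[OF ij(2)] by linarith
    qed
  qed
  then obtain x where "(\<lambda>i. Bochner_Integration.simple_bochner_integral M (s i)) \<longlonglongrightarrow> x"
    by (auto simp: Cauchy_convergent_iff convergent_def)
  then show ?thesis
    unfolding lint_integrable_def has_lint_def using f s 1 by blast
qed

lemma lint_integrable_indicator:
  assumes "finite_measure M" "A \<in> sets M" "lint_integrable M f"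
  shows "lint_integrable M (\<lambda>x. indicator A x *\<^sub>R f x)"
proof (rule lint_integrableI_finite[OF assms(1)])
  show "strongly_measurable M (\<lambda>x. indicator A x *\<^sub>R f x)"
    using assms(2,3) by (auto intro!: strongly_measurable_indicator simp: lint_integrable_def has_lint_def)
  have "(\<integral>\<^sup>+ x. ennreal (norm (indicator A x *\<^sub>R f x)) \<partial>M) \<le> (\<integral>\<^sup>+ x. ennreal (norm (f x)) \<partial>M)"
    by (intro nn_integral_mono) (auto simp: indicator_def)
  then show "(\<integral>\<^sup>+ x. ennreal (norm (indicator A x *\<^sub>R f x)) \<partial>M) < \<infinity>"
    using lint_integrableD_finite[OF assms(3)] by (rule order.strict_trans1)
qed

lemma has_lint_unif_sym:
  "has_lint (unif_sym n) f ((\<Sum>\<pi>\<in>sym_group n. f \<pi>) /\<^sub>R fact n)"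
proof -
  let ?M = "unif_sym n"
  have fin: "finite (sym_group n)"
    by (simp add: finite_permutations)
  have sp: "space ?M = sym_group n" "sets ?M = Pow (sym_group n)"
    by (auto simp: unif_sym_def space_uniform_count_measure sets_uniform_count_measure)
  have sbi: "Bochner_Integration.simple_bochner_integrable ?M f"
    unfolding simple_bochner_integrable.simps simple_function_def sp
    using fin emeasure_uniform_count_measure[OF fin, of "{y \<in> sym_group n. f y \<noteq> 0}"]
    by (auto simp: sp unif_sym_def Collect_mono_iff)
  have card: "card (sym_group n) = fact n"
    by (rule card_permutations) auto
  have "Bochner_Integration.simple_bochner_integral ?M f = (\<Sum>y\<in>id ` space ?M. measure ?M {x\<in>space ?M. id x = y} *\<^sub>R f y)"
    using fin by (intro simple_bochner_integral_partition[OF sbi]) (auto simp: simple_function_def sp)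
  also have "\<dots> = (\<Sum>y\<in>sym_group n. (1 / fact n) *\<^sub>R f y)"
  proof (unfold sp image_id id_apply, rule sum.cong[OF refl])
    fix y assume y: "y \<in> sym_group n"
    then have "{x \<in> sym_group n. x = y} = {y}" by auto
    then show "measure ?M {x \<in> sym_group n. x = y} *\<^sub>R f y = (1 / fact n) *\<^sub>R f y"
      using fin y card by (simp add: unif_sym_def measure_uniform_count_measure)
  qed
  also have "\<dots> = (\<Sum>\<pi>\<in>sym_group n. f \<pi>) /\<^sub>R fact n"
    by (simp add: scaleR_sum_right divide_inverse)
  finally show ?thesis
    using has_lint_simple[OF sbi] by simp
qed

lemma lint_unif_sym: "lint (unif_sym n) f = (\<Sum>\<pi>\<in>sym_group n. f \<pi>) /\<^sub>R fact n"
  by (rule lint_eq[OF has_lint_unif_sym])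


section \<open>Independence of the sample space\<close>

lemma has_lint_distr:
  assumes \<phi>: "\<phi> \<in> measurable M N" and onto: "\<phi> ` space M = space N"
    and h: "has_lint (distr M N \<phi>) f x"
  shows "has_lint M (\<lambda>\<omega>. f (\<phi> \<omega>)) x"
proof -
  let ?N = "distr M N \<phi>"
  obtain s where s: "\<And>i. Bochner_Integration.simple_bochner_integrable ?N (s i)"
    "(\<lambda>i. \<integral>\<^sup>+ \<omega>. ennreal (norm (f \<omega> - s i \<omega>)) \<partial>?N) \<longlonglongrightarrow> 0"
    "(\<lambda>i. Bochner_Integration.simple_bochner_integral ?N (s i)) \<longlonglongrightarrow> x"
    and f: "strongly_measurable ?N f"
    using h by (auto simp: has_lint_def)
  have fm: "f \<in> borel_measurable N" "f \<in> borel_measurable ?N"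
    using f by (auto simp: strongly_measurable_def)
  have sf: "simple_function ?N (s i)" and sN: "simple_function N (s i)" for i
    using s(1)[of i] by (auto elim!: simple_bochner_integrable.cases simp: simple_function_def)
  have "strongly_measurable M (\<lambda>\<omega>. f (\<phi> \<omega>))"
    using f onto measurable_compose[OF \<phi> fm(1)]
    by (simp add: strongly_measurable_def image_image[symmetric])
  moreover have pre: "\<phi> -` {y \<in> space N. P y} \<inter> space M = {\<omega> \<in> space M. P (\<phi> \<omega>)}" for P
    using onto by auto
  have lvl: "{y \<in> space N. s i y = z} \<in> sets N" "{y \<in> space N. s i y \<noteq> 0} \<in> sets N" for i z
  proof -
    have [measurable]: "s i \<in> measurable N (count_space UNIV)"
      by (rule measurable_simple_function[OF sN])
    show "{y \<in> space N. s i y = z} \<in> sets N" "{y \<in> space N. s i y \<noteq> 0} \<in> sets N"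
      by measurable
  qed
  have "Bochner_Integration.simple_bochner_integrable M (\<lambda>\<omega>. s i (\<phi> \<omega>))" for i
  proof
    have "(\<lambda>\<omega>. s i (\<phi> \<omega>)) \<in> measurable M (count_space UNIV)"
      by (rule measurable_compose[OF \<phi> measurable_simple_function[OF sN]])
    moreover have "finite ((\<lambda>\<omega>. s i (\<phi> \<omega>)) ` space M)"
      using simple_functionD(1)[OF sN[of i]] onto by (simp add: image_image[symmetric])
    ultimately show "simple_function M (\<lambda>\<omega>. s i (\<phi> \<omega>))"
      by (auto simp: simple_function_def intro: measurable_sets)
    show "emeasure M {\<omega> \<in> space M. s i (\<phi> \<omega>) \<noteq> 0} \<noteq> \<infinity>"
      using s(1)[of i] 
      unfolding simple_bochner_integrable.simps space_distr emeasure_distr[OF \<phi> lvl(2)] pre by blast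
  qed
  moreover have "(\<integral>\<^sup>+ \<omega>. ennreal (norm (f \<omega> - s i \<omega>)) \<partial>?N) = (\<integral>\<^sup>+ \<omega>. ennreal (norm (f (\<phi> \<omega>) - s i (\<phi> \<omega>))) \<partial>M)" for i
    using measurable_norm_diff_simple[OF fm(2) sf[of i]] by (intro nn_integral_distr \<phi>) auto
  moreover have "Bochner_Integration.simple_bochner_integral ?N (s i) = Bochner_Integration.simple_bochner_integral M (\<lambda>\<omega>. s i (\<phi> \<omega>))" for i
  proof -
    have "s i ` space N = (\<lambda>\<omega>. s i (\<phi> \<omega>)) ` space M"
      unfolding onto[symmetric] image_image ..
    then show ?thesis
      unfolding simple_bochner_integral_def space_distr measure_distr[OF \<phi> lvl(1)] pre by simp
  qed
  ultimately show ?thesis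
    unfolding has_lint_def using s(2,3) by (auto intro!: exI[of _ "\<lambda>i \<omega>. s i (\<phi> \<omega>)"])
qed

definition image_algebra :: "('a \<Rightarrow> 'b) \<Rightarrow> 'a measure \<Rightarrow> 'b measure" where
  "image_algebra \<phi> M = sigma (\<phi> ` space M) {B. B \<subseteq> \<phi> ` space M \<and> \<phi> -` B \<inter> space M \<in> sets M}"

lemma space_image_algebra [simp]: "space (image_algebra \<phi> M) = \<phi> ` space M"
  by (auto simp: image_algebra_def intro!: space_measure_of)

lemma sets_image_algebra:
  "sets (image_algebra \<phi> M) = {B. B \<subseteq> \<phi> ` space M \<and> \<phi> -` B \<inter> space M \<in> sets M}"
proof -
  have "sigma_algebra (\<phi> ` space M) {B. B \<subseteq> \<phi> ` space M \<and> \<phi> -` B \<inter> space M \<in> sets M}" (is "sigma_algebra _ ?S")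
    unfolding sigma_algebra_iff2
  proof (intro conjI ballI allI impI)
    fix B assume B: "B \<in> ?S"
    have "\<phi> -` (\<phi> ` space M - B) \<inter> space M = space M - \<phi> -` B \<inter> space M" by auto
    then show "\<phi> ` space M - B \<in> ?S" using B by auto
  next
    fix A :: "nat \<Rightarrow> _" assume A: "range A \<subseteq> ?S"
    have "\<phi> -` (\<Union>i. A i) \<inter> space M = (\<Union>i. \<phi> -` A i \<inter> space M)" by auto
    also have "\<dots> \<in> sets M" using A by (intro sets.countable_UN) auto
    finally show "(\<Union>i. A i) \<in> ?S" using A by auto
  qed auto
  then show ?thesis
    unfolding image_algebra_def by (intro sigma_algebra.sets_measure_of_eq)
qed

lemma martingale_type_2_bound_any_space:
  assumes C: "martingale_type_2_bound C TYPE(nat \<Rightarrow> 'e) TYPE('e::banach)"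
  shows "martingale_type_2_bound C TYPE('w) TYPE('e)"
  unfolding martingale_type_2_bound_def
proof (intro allI impI, elim conjE)
  fix n :: nat and \<mu> :: "'w measure" and F and X :: "nat \<Rightarrow> 'w \<Rightarrow> 'e"
  assume \<mu>: "prob_space \<mu>" and mart: "martingale_upto n \<mu> F X"
  interpret prob_space \<mu> by fact
  define \<phi> where "\<phi> \<omega> = (\<lambda>i. X i \<omega>)" for \<omega>
  define G where "G i = image_algebra \<phi> (F i)" for i
  define I where "I = image_algebra \<phi> \<mu>"
  define N where "N = distr \<mu> I \<phi>"
  define Y where "Y i p = p i" for i and p :: "nat \<Rightarrow> 'e"
  have Y\<phi>: "Y i (\<phi> \<omega>) = X i \<omega>" for i \<omega>
    by (simp add: Y_def \<phi>_def)
  have \<phi>: "\<phi> \<in> measurable \<mu> I"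
    by (rule measurableI) (auto simp: I_def sets_image_algebra)
  have onto: "\<phi> ` space \<mu> = space I"
    by (simp add: I_def)
  have N: "prob_space N"
    unfolding N_def by (rule prob_space_distr[OF \<phi>])
  then have Nf: "finite_measure N"
    by (simp add: prob_space_def)
  have sub: "subalgebra \<mu> (F i)" if "i \<le> n" for i
    using mart that by (auto simp: martingale_upto_def)
  have subF: "subalgebra (F j) (F i)" if "i \<le> j" "j \<le> n" for i j
    using mart that by (auto simp: martingale_upto_def)
  have sm: "strongly_measurable (F i) (X i)" and int: "lint_integrable \<mu> (X i)" if "i \<le> n" for i
    using mart that by (auto simp: martingale_upto_def)
  have subN: "subalgebra N (G i)" if "i \<le> n" for i
    using sub[OF that] by (auto simp: subalgebra_def N_def I_def G_def sets_image_algebra)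
  have subG: "subalgebra (G j) (G i)" if "i \<le> j" "j \<le> n" for i j
    using subF[OF that] by (auto simp: subalgebra_def G_def sets_image_algebra)
  have smG: "strongly_measurable (G i) (Y i)" if i: "i \<le> n" for i
  proof -
    obtain D where D: "countable D" "X i ` space (F i) \<subseteq> closure D" and m: "X i \<in> borel_measurable (F i)"
      using sm[OF i] by (auto simp: strongly_measurable_def)
    have "Y i \<in> borel_measurable (G i)"
    proof (rule measurableI)
      fix A :: "'e set" assume A: "A \<in> sets borel"
      have "\<phi> -` (Y i -` A \<inter> space (G i)) \<inter> space (F i) = X i -` A \<inter> space (F i)"
        unfolding G_def space_image_algebra by (auto simp: Y\<phi>) (metis Y\<phi>)+
      then show "Y i -` A \<inter> space (G i) \<in> sets (G i)"
        using measurable_sets[OF m A] by (auto simp: G_def sets_image_algebra)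
    qed auto
    moreover have "Y i ` space (G i) = X i ` space (F i)"
      by (auto simp: G_def image_image Y\<phi>)
    ultimately show ?thesis
      using D by (auto simp: strongly_measurable_def)
  qed
  have smN: "strongly_measurable N (Y i)" if i: "i \<le> n" for i
    using smG[OF i] subN[OF i] measurable_from_subalg
    by (auto simp: strongly_measurable_def subalgebra_def)
  have intN: "lint_integrable N (Y i)" if i: "i \<le> n" for i
  proof (rule lint_integrableI_finite[OF Nf smN[OF i]])
    have "strongly_measurable N (\<lambda>_. 0 :: 'e)"
      by (auto simp: strongly_measurable_def intro!: exI[of _ "{0}"])
    then have "(\<lambda>p. ennreal (norm (Y i p - 0))) \<in> borel_measurable N"
      by (rule measurable_norm_diff[OF smN[OF i]])
    then have "(\<integral>\<^sup>+ p. ennreal (norm (Y i p)) \<partial>N) = (\<integral>\<^sup>+ \<omega>. ennreal (norm (Y i (\<phi> \<omega>))) \<partial>\<mu>)"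
      unfolding N_def by (intro nn_integral_distr \<phi>) simp
    then show "(\<integral>\<^sup>+ p. ennreal (norm (Y i p)) \<partial>N) < \<infinity>"
      using lint_integrableD_finite[OF int[OF i]] by (simp add: Y\<phi>)
  qed
  have lintN: "lint N (\<lambda>p. indicator B p *\<^sub>R Y i p) = lint \<mu> (\<lambda>\<omega>. indicator (\<phi> -` B \<inter> space \<mu>) \<omega> *\<^sub>R X i \<omega>)"
    if B: "B \<in> sets N" and i: "i \<le> n" for B i
  proof -
    obtain x where x: "has_lint N (\<lambda>p. indicator B p *\<^sub>R Y i p) x"
      using lint_integrable_indicator[OF Nf B intN[OF i]] by (auto simp: lint_integrable_def)
    have "has_lint \<mu> (\<lambda>\<omega>. indicator B (\<phi> \<omega>) *\<^sub>R Y i (\<phi> \<omega>)) x"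
      using has_lint_distr[OF \<phi> onto x[unfolded N_def]] .
    then have "lint \<mu> (\<lambda>\<omega>. indicator B (\<phi> \<omega>) *\<^sub>R Y i (\<phi> \<omega>)) = x"
      by (rule lint_eq)
    moreover have "lint \<mu> (\<lambda>\<omega>. indicator B (\<phi> \<omega>) *\<^sub>R Y i (\<phi> \<omega>))
        = lint \<mu> (\<lambda>\<omega>. indicator (\<phi> -` B \<inter> space \<mu>) \<omega> *\<^sub>R X i \<omega>)"
      by (rule lint_cong) (auto simp: Y\<phi> indicator_def)
    ultimately show ?thesis
      using lint_eq[OF x] by simp
  qed
  have "martingale_upto n N G Y"
    unfolding martingale_upto_def
  proof (intro conjI allI impI ballI)
    fix i B assume i: "i < n" and B: "B \<in> sets (G i)"
    have BN: "B \<in> sets N"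
      using subN[of i] i B by (auto simp: subalgebra_def)
    have "\<phi> -` B \<inter> space \<mu> \<in> sets (F i)"
      using B sub[of i] i by (auto simp: G_def sets_image_algebra subalgebra_def)
    then have "lint \<mu> (\<lambda>\<omega>. indicator (\<phi> -` B \<inter> space \<mu>) \<omega> *\<^sub>R X (Suc i) \<omega>)
        = lint \<mu> (\<lambda>\<omega>. indicator (\<phi> -` B \<inter> space \<mu>) \<omega> *\<^sub>R X i \<omega>)"
      using mart i by (auto simp: martingale_upto_def)
    then show "lint N (\<lambda>p. indicator B p *\<^sub>R Y (Suc i) p) = lint N (\<lambda>p. indicator B p *\<^sub>R Y i p)"
      using i by (simp add: lintN[OF BN])
  qed (auto intro: subN subG smG intN)
  then have ineq: "(\<integral>\<^sup>+ p. ennreal ((norm (Y n p - Y 0 p))\<^sup>2) \<partial>N)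
      \<le> ennreal (C\<^sup>2) * (\<Sum>i=1..n. \<integral>\<^sup>+ p. ennreal ((norm (Y i p - Y (i - 1) p))\<^sup>2) \<partial>N)"
    using C N unfolding martingale_type_2_bound_def by blast
  have tr: "(\<integral>\<^sup>+ p. ennreal ((norm (Y i p - Y j p))\<^sup>2) \<partial>N) = (\<integral>\<^sup>+ \<omega>. ennreal ((norm (X i \<omega> - X j \<omega>))\<^sup>2) \<partial>\<mu>)"
    if ij: "i \<le> n" "j \<le> n" for i j
  proof -
    have "(\<lambda>p. (ennreal (norm (Y i p - Y j p)))\<^sup>2) \<in> borel_measurable N"
      using measurable_norm_diff[OF smN[OF ij(1)] smN[OF ij(2)]] by measurable
    then have "(\<lambda>p. ennreal ((norm (Y i p - Y j p))\<^sup>2)) \<in> borel_measurable N"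
      by (simp add: ennreal_power)
    then have "(\<integral>\<^sup>+ p. ennreal ((norm (Y i p - Y j p))\<^sup>2) \<partial>N)
        = (\<integral>\<^sup>+ \<omega>. ennreal ((norm (Y i (\<phi> \<omega>) - Y j (\<phi> \<omega>)))\<^sup>2) \<partial>\<mu>)"
      unfolding N_def by (intro nn_integral_distr \<phi>) simp
    then show ?thesis
      by (simp add: Y\<phi>)
  qed
  have "(\<Sum>i=1..n. \<integral>\<^sup>+ p. ennreal ((norm (Y i p - Y (i - 1) p))\<^sup>2) \<partial>N)
      = (\<Sum>i=1..n. \<integral>\<^sup>+ \<omega>. ennreal ((norm (X i \<omega> - X (i - 1) \<omega>))\<^sup>2) \<partial>\<mu>)"
    by (intro sum.cong refl tr) auto
  with ineq show "(\<integral>\<^sup>+ \<omega>. ennreal ((norm (X n \<omega> - X 0 \<omega>))\<^sup>2) \<partial>\<mu>)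
      \<le> ennreal (C\<^sup>2) * (\<Sum>i=1..n. \<integral>\<^sup>+ \<omega>. ennreal ((norm (X i \<omega> - X (i - 1) \<omega>))\<^sup>2) \<partial>\<mu>)"
    by (simp add: tr)
qed

end

theory Submission
  imports Defs
begin

text \<open>
  Reveal \<open>inv \<pi> 1, inv \<pi> 2, \<dots>\<close> one after the other. Averaging \<open>f\<close> over the permutations that fix
  \<open>1, \<dots>, i\<close> gives a martingale whose \<open>i\<close>-th increment is an average of differences of \<open>f\<close>
  along the transpositions \<open>(i j)\<close> with \<open>j > i\<close>, each with weight \<open>1 / (n - i + 1)\<close>. Martingale type 2 bounds
  the variance of \<open>f\<close> by the resulting weighted energy. Along the same filtration the entropy of the
  square of a real function \<open>g\<close> telescopes into entropies on \<open>n - i + 1\<close> points, and the logarithmic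
  Sobolev inequality on a complete graph costs a factor \<open>ln n\<close>. Applying both bounds to
  \<open>\<pi> \<mapsto> f (\<sigma> \<circ> \<pi>)\<close> and averaging over \<open>\<sigma>\<close> replaces the weights by \<open>2 / (n - 1)\<close> for every transposition.
  With \<open>g = norm (f - E f)\<close>, the Gibbs inequality
  \<open>E (X ln (e + X)) \<le> Ent X + E X ln (e + E X)\<close> for \<open>X = g\<^sup>2 / \<gamma>\<^sup>2\<close> turns variance and entropy
  bounds into the Orlicz norm bound.
\<close>

section \<open>Averages over cosets\<close>

lemmas sum_permutations_compose_left = setum_permutations_compose_left[symmetric]

text \<open>Under the uniform measure, \<open>coset_avg S f\<close> is the conditional expectation of \<open>f \<pi>\<close> given the
  values of \<open>inv \<pi>\<close> outside \<open>S\<close>.\<close>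

definition coset_avg :: "nat set \<Rightarrow> ((nat \<Rightarrow> nat) \<Rightarrow> 'e::real_vector) \<Rightarrow> (nat \<Rightarrow> nat) \<Rightarrow> 'e" where
  "coset_avg S f \<pi> = (\<Sum>h | h permutes S. f (h \<circ> \<pi>)) /\<^sub>R fact (card S)"

text \<open>Right translation by \<open>h\<close> merely permutes the group averaged over. This
  invariance makes the averages measurable for \<open>coset_algebra\<close>.\<close>

lemma coset_avg_compose:
  assumes "h permutes S"
  shows "coset_avg S f (h \<circ> \<pi>) = coset_avg S f \<pi>"
  unfolding coset_avg_def
  using sum_permutations_compose_right[OF assms, of "\<lambda>p. f (p \<circ> \<pi>)"] by (simp add: o_assoc)

lemma coset_avg_empty [simp]: "coset_avg {} f = f"
  by (rule ext) (simp add: coset_avg_def permutes_empty)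

text \<open>Every permutation of \<open>insert i S\<close> is
  \<open>Transposition.transpose i j \<circ> h\<close> for exactly one \<open>j\<close> in
  \<open>insert i S\<close> and one \<open>h\<close> permuting \<open>S\<close>.\<close>

lemma coset_avg_insert:
  assumes fin: "finite S" and i: "i \<notin> S"
  shows "coset_avg (insert i S) f \<pi>
    = (\<Sum>j\<in>insert i S. coset_avg S f (Transposition.transpose i j \<circ> \<pi>)) /\<^sub>R real (Suc (card S))"
proof -
  \<comment> \<open>Inversion reverses this factorisation: the transposition ends up next to
    \<open>\<pi>\<close>, and the inner sum becomes an average over \<open>S\<close>.\<close>
  have "(\<Sum>h | h permutes insert i S. f (h \<circ> \<pi>)) = (\<Sum>h | h permutes insert i S. f (inv h \<circ> \<pi>))"
    by (rule sum_permutations_inverse)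
  also have "\<dots> = (\<Sum>j\<in>insert i S. \<Sum>h | h permutes S. f (inv (Transposition.transpose i j \<circ> h) \<circ> \<pi>))"
    by (rule sum_over_permutations_insert[OF fin i])
  also have "\<dots> = (\<Sum>j\<in>insert i S. \<Sum>h | h permutes S. f (inv h \<circ> (Transposition.transpose i j \<circ> \<pi>)))"
    by (intro sum.cong refl) (simp add: o_inv_distrib permutes_bij o_assoc)
  also have "\<dots> = (\<Sum>j\<in>insert i S. \<Sum>h | h permutes S. f (h \<circ> (Transposition.transpose i j \<circ> \<pi>)))"
    by (intro sum.cong refl sum_permutations_inverse[symmetric])
  finally show ?thesis
    using assms by (simp add: coset_avg_def scaleR_sum_right[symmetric])
qed

text \<open>Conjugating \<open>(i j)\<close> by \<open>h\<close>, which fixes \<open>i\<close>, turns it into \<open>(i (h j))\<close>.\<close>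

lemma sum_transposition_pairs_coset:
  fixes F :: "(nat \<Rightarrow> nat) \<Rightarrow> (nat \<Rightarrow> nat) \<Rightarrow> real"
  assumes S: "S \<subseteq> {1..n}" and i: "i \<notin> S"
  shows "(\<Sum>j\<in>S. \<Sum>\<pi>\<in>sym_group n. (\<Sum>h | h permutes S. F (h \<circ> \<pi>) (h \<circ> (Transposition.transpose i j \<circ> \<pi>))) / fact (card S))
    = (\<Sum>j\<in>S. \<Sum>\<pi>\<in>sym_group n. F \<pi> (Transposition.transpose i j \<circ> \<pi>))" (is "?L = ?R")
proof -
  have fin: "finite S" using S finite_subset by blast
  \<comment> \<open>For fixed \<open>h\<close>, the translation
    \<open>\<pi> \<mapsto> h \<circ> \<pi>\<close> and the relabelling
    \<open>j \<mapsto> h j\<close> only permute the terms, so the average over \<open>h\<close>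
    drops out.\<close>
  have eq: "(\<Sum>j\<in>S. \<Sum>\<pi>\<in>sym_group n. F (h \<circ> \<pi>) (h \<circ> (Transposition.transpose i j \<circ> \<pi>))) = ?R"
    if h: "h permutes S" for h
  proof -
    have hi: "h i = i"
      using h i by (simp add: permutes_not_in)
    have comm: "h \<circ> (Transposition.transpose i j \<circ> \<pi>) = Transposition.transpose i (h j) \<circ> (h \<circ> \<pi>)" for j and \<pi> :: "nat \<Rightarrow> nat"
      using transpose_comp_eq[OF permutes_bij[OF h], of i "h j"] hi
      by (metis fun.map_comp h permutes_inverses(2))
    have "(\<Sum>j\<in>S. \<Sum>\<pi>\<in>sym_group n. F (h \<circ> \<pi>) (h \<circ> (Transposition.transpose i j \<circ> \<pi>)))
        = (\<Sum>j\<in>S. \<Sum>\<pi>\<in>sym_group n. F \<pi> (Transposition.transpose i (h j) \<circ> \<pi>))"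
      unfolding comm
      by (intro sum.cong refl sum_permutations_compose_left[where f="\<lambda>\<pi>. F \<pi> (Transposition.transpose i (h _) \<circ> \<pi>)"]
        permutes_subset[OF h S])
    also have "\<dots> = ?R"
      by (rule sum.reindex_bij_betw[OF permutes_imp_bij[OF h]])
    finally show ?thesis .
  qed
  have "?L = (\<Sum>h | h permutes S. \<Sum>j\<in>S. \<Sum>\<pi>\<in>sym_group n. F (h \<circ> \<pi>) (h \<circ> (Transposition.transpose i j \<circ> \<pi>))) / fact (card S)"
    unfolding sum_divide_distrib[symmetric]
    by (subst sum.swap[of _ _ "{h. h permutes S}"]) (simp add: sum.swap[of _ _ "{h. h permutes S}"])
  also have "\<dots> = (\<Sum>h | h permutes S. ?R) / fact (card S)"
    by (intro arg_cong[where f="\<lambda>x. x / _"] sum.cong refl eq) simp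
  also have "\<dots> = ?R"
    by (simp add: card_permutations[OF refl fin])
  finally show ?thesis .
qed

section \<open>Quadratic means: Jensen and the reverse triangle inequality\<close>

text \<open>Triangle inequality, then Cauchy-Schwarz.\<close>

lemma norm_mean_sq_le:
  fixes x :: "'a \<Rightarrow> 'e::real_normed_vector"
  assumes "finite A" "A \<noteq> {}"
  shows "(norm ((\<Sum>a\<in>A. x a) /\<^sub>R real (card A)))\<^sup>2 \<le> (\<Sum>a\<in>A. (norm (x a))\<^sup>2) / real (card A)"
proof -
  have c: "real (card A) > 0" using assms by (simp add: card_gt_0_iff)
  have "(norm (\<Sum>a\<in>A. x a))\<^sup>2 \<le> (\<Sum>a\<in>A. norm (x a))\<^sup>2"
    by (intro power_mono norm_sum) simp
  also have "\<dots> \<le> (\<Sum>a\<in>A. (norm (x a))\<^sup>2) * card A"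
    by (rule sum_squared_le_sum_of_squares)
  finally show ?thesis
    using c by (simp add: field_simps power2_eq_square)
qed

text \<open>Reverse triangle inequality for \<open>L2_set\<close>. Through it, the root of a
  conditional second moment inherits energy bounds from the function itself.\<close>

lemma sqrt_mean_square_diff_le:
  fixes a b :: "'a \<Rightarrow> real" and N :: real
  assumes "N > 0"
  shows "(sqrt ((\<Sum>k\<in>A. (a k)\<^sup>2) / N) - sqrt ((\<Sum>k\<in>A. (b k)\<^sup>2) / N))\<^sup>2 \<le> (\<Sum>k\<in>A. (a k - b k)\<^sup>2) / N"
proof -
  have tri: "L2_set x A \<le> L2_set y A + L2_set (\<lambda>k. x k - y k) A" for x y :: "'a \<Rightarrow> real"
    using L2_set_triangle_ineq[of y "\<lambda>k. x k - y k" A] by simp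
  have "L2_set (\<lambda>k. b k - a k) A = L2_set (\<lambda>k. a k - b k) A"
    by (simp add: L2_set_def power2_commute)
  then have "\<bar>L2_set a A - L2_set b A\<bar> \<le> L2_set (\<lambda>k. a k - b k) A"
    using tri[of a b] tri[of b a] by linarith
  then have "(L2_set a A - L2_set b A)\<^sup>2 \<le> (L2_set (\<lambda>k. a k - b k) A)\<^sup>2"
    by (metis abs_ge_zero power2_abs power_mono)
  moreover have "(sqrt ((\<Sum>k\<in>A. (a k)\<^sup>2) / N) - sqrt ((\<Sum>k\<in>A. (b k)\<^sup>2) / N))\<^sup>2 = (L2_set a A - L2_set b A)\<^sup>2 / N"
    using assms by (simp add: L2_set_def real_sqrt_divide diff_divide_distrib[symmetric] power_divide)
  moreover have "(L2_set (\<lambda>k. a k - b k) A)\<^sup>2 = (\<Sum>k\<in>A. (a k - b k)\<^sup>2)"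
    by (simp add: L2_set_def sum_nonneg)
  ultimately show ?thesis
    using assms by (simp add: divide_right_mono)
qed

section \<open>Energies along transpositions and the martingale increments\<close>

definition transp_energy :: "nat \<Rightarrow> ((nat \<Rightarrow> nat) \<Rightarrow> 'e::real_normed_vector) \<Rightarrow> nat \<Rightarrow> nat \<Rightarrow> real" where
  "transp_energy n f i j = (\<Sum>\<pi>\<in>sym_group n. (norm (f \<pi> - f (Transposition.transpose i j \<circ> \<pi>)))\<^sup>2)"

text \<open>\<open>Suc (n - i)\<close> counts the points of \<open>{i..n}\<close>, the possible
  partners of \<open>i\<close> in the averaging step, \<open>i\<close> itself included. The value
  depends on the order in which the points are revealed.\<close>

definition ordered_energy :: "nat \<Rightarrow> ((nat \<Rightarrow> nat) \<Rightarrow> 'e::real_normed_vector) \<Rightarrow> real" where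
  "ordered_energy n f = (\<Sum>i=1..n. (\<Sum>j\<in>{i<..n}. transp_energy n f i j) / real (Suc (n - i)))"

lemma transp_energy_nonneg: "0 \<le> transp_energy n f i j"
  by (simp add: transp_energy_def sum_nonneg)

lemma insert_greaterThanAtMost:
  assumes "i \<in> {1..n::nat}"
  shows "insert i {i<..n} = {i - 1<..n}"
  using assms by auto

lemma coset_avg_step:
  assumes "i \<in> {1..n}"
  shows "coset_avg {i - 1<..n} f \<pi>
    = (\<Sum>j\<in>insert i {i<..n}. coset_avg {i<..n} f (Transposition.transpose i j \<circ> \<pi>)) /\<^sub>R real (Suc (n - i))"
  using coset_avg_insert[of "{i<..n}" i f \<pi>] insert_greaterThanAtMost[OF assms] by simp

text \<open>Jensen is used twice: over the transpositions \<open>?t j\<close> that link two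
  successive averages, then over the permutations \<open>h\<close> inside each average. Summing over
  the group removes \<open>h\<close> by \<open>sum_transposition_pairs_coset\<close>.\<close>

lemma coset_avg_increment:
  fixes f :: "(nat \<Rightarrow> nat) \<Rightarrow> 'e::real_normed_vector"
  assumes i: "i \<in> {1..n}"
  shows "(\<Sum>\<pi>\<in>sym_group n. (norm (coset_avg {i<..n} f \<pi> - coset_avg {i - 1<..n} f \<pi>))\<^sup>2)
    \<le> (\<Sum>j\<in>{i<..n}. transp_energy n f i j) / real (Suc (n - i))"
proof -
  let ?S = "{i<..n}" and ?m = "real (Suc (n - i))"
  let ?X = "coset_avg {i<..n} f"
  let ?t = "Transposition.transpose i"
  have pt: "(norm (?X \<pi> - coset_avg {i - 1<..n} f \<pi>))\<^sup>2
      \<le> (\<Sum>j\<in>?S. (norm (?X \<pi> - ?X (?t j \<circ> \<pi>)))\<^sup>2) / ?m" for \<pi>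
  proof -
    have card: "card (insert i ?S) = Suc (n - i)" by simp
    have "?X \<pi> = (\<Sum>j\<in>insert i ?S. ?X \<pi>) /\<^sub>R ?m"
      by (simp add: sum_constant_scaleR del: sum.insert of_nat_Suc)
    then have "?X \<pi> - coset_avg {i - 1<..n} f \<pi>
        = (\<Sum>j\<in>insert i ?S. ?X \<pi> - ?X (?t j \<circ> \<pi>)) /\<^sub>R ?m"
      using coset_avg_step[OF i, of f \<pi>] by (simp add: sum_subtractf scaleR_diff_right del: sum.insert of_nat_Suc)
    then have "(norm (?X \<pi> - coset_avg {i - 1<..n} f \<pi>))\<^sup>2
        \<le> (\<Sum>j\<in>insert i ?S. (norm (?X \<pi> - ?X (?t j \<circ> \<pi>)))\<^sup>2) / ?m"
      using norm_mean_sq_le[of "insert i ?S" "\<lambda>j. ?X \<pi> - ?X (?t j \<circ> \<pi>)"]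
      unfolding card by (metis finite.insertI finite_greaterThanAtMost insert_not_empty)
    \<comment> \<open>The term \<open>j = i\<close> vanishes since \<open>?t i\<close> is the
      identity; the divisor \<open>?m\<close> still counts it.\<close>
    then show ?thesis by simp
  qed
  have av: "(norm (?X \<pi> - ?X (?t j \<circ> \<pi>)))\<^sup>2
      \<le> (\<Sum>h | h permutes ?S. (norm (f (h \<circ> \<pi>) - f (h \<circ> (?t j \<circ> \<pi>))))\<^sup>2) / fact (card ?S)" for j \<pi>
  proof -
    have "card {h. h permutes ?S} = fact (card ?S)"
      by (rule card_permutations[OF refl]) simp
    moreover have "{h. h permutes ?S} \<noteq> {}" using permutes_id by blast
    ultimately show ?thesis
      using norm_mean_sq_le[of "{h. h permutes ?S}" "\<lambda>h. f (h \<circ> \<pi>) - f (h \<circ> (?t j \<circ> \<pi>))"]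
      by (simp add: coset_avg_def sum_subtractf scaleR_diff_right finite_permutations)
  qed
  have "(\<Sum>\<pi>\<in>sym_group n. (norm (?X \<pi> - coset_avg {i - 1<..n} f \<pi>))\<^sup>2)
      \<le> (\<Sum>\<pi>\<in>sym_group n. (\<Sum>j\<in>?S. (\<Sum>h | h permutes ?S. (norm (f (h \<circ> \<pi>) - f (h \<circ> (?t j \<circ> \<pi>))))\<^sup>2) / fact (card ?S)) / ?m)"
    by (intro sum_mono order_trans[OF pt] divide_right_mono av) simp
  also have "\<dots> = (\<Sum>j\<in>?S. \<Sum>\<pi>\<in>sym_group n. (\<Sum>h | h permutes ?S. (norm (f (h \<circ> \<pi>) - f (h \<circ> (?t j \<circ> \<pi>))))\<^sup>2) / fact (card ?S)) / ?m"
    unfolding sum_divide_distrib[where r="?m", symmetric] by (subst sum.swap) (rule refl)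
  also have "\<dots> = (\<Sum>j\<in>?S. transp_energy n f i j) / ?m"
    unfolding transp_energy_def
    using i by (subst sum_transposition_pairs_coset[where F="\<lambda>\<pi> \<rho>. (norm (f \<pi> - f \<rho>))\<^sup>2"]) auto
  finally show ?thesis .
qed

lemma coset_avg_full:
  assumes "\<pi> permutes {1..n}"
  shows "coset_avg {1..n} f \<pi> = (\<Sum>\<rho>\<in>sym_group n. f \<rho>) /\<^sub>R fact n"
  unfolding coset_avg_def using sum_permutations_compose_right[OF assms, of f] by simp

section \<open>Variance and martingale type\<close>

lemma nn_integral_unif_sym:
  assumes "\<And>\<pi>. 0 \<le> g \<pi>"
  shows "(\<integral>\<^sup>+ \<pi>. ennreal (g \<pi>) \<partial>unif_sym n) = ennreal ((\<Sum>\<pi>\<in>sym_group n. g \<pi>) / fact n)"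
proof -
  have fin: "finite (sym_group n)" by (simp add: finite_permutations)
  have card: "card (sym_group n) = fact n" by (rule card_permutations) auto
  have "(\<integral>\<^sup>+ \<pi>. ennreal (g \<pi>) \<partial>unif_sym n) = (\<Sum>\<pi>\<in>sym_group n. ennreal (g \<pi>) * ennreal (1 / fact n))"
    unfolding unif_sym_def uniform_count_measure_def card
    by (subst nn_integral_point_measure_finite[OF fin]) (simp add: mult.commute)
  also have "\<dots> = (\<Sum>\<pi>\<in>sym_group n. ennreal (g \<pi> / fact n))"
    by (intro sum.cong refl) (simp add: assms ennreal_mult[symmetric])
  finally show ?thesis
    by (simp add: assms sum_divide_distrib)
qed

section \<open>The coset filtration and its martingale\<close>

text \<open>The \<open>\<sigma>\<close>-algebra generated by the values of \<open>inv \<pi>\<close> at \<open>1, \<dots>, i\<close>.\<close>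

definition coset_algebra :: "nat \<Rightarrow> nat \<Rightarrow> (nat \<Rightarrow> nat) measure" where
  "coset_algebra n i = sigma (sym_group n)
     {A. A \<subseteq> sym_group n \<and> (\<forall>h \<pi>. h permutes {i<..n} \<longrightarrow> \<pi> \<in> A \<longrightarrow> h \<circ> \<pi> \<in> A)}"

lemma space_coset_algebra [simp]: "space (coset_algebra n i) = sym_group n"
  by (auto simp: coset_algebra_def intro!: space_measure_of)

lemma sets_coset_algebra:
  "sets (coset_algebra n i) =
     {A. A \<subseteq> sym_group n \<and> (\<forall>h \<pi>. h permutes {i<..n} \<longrightarrow> \<pi> \<in> A \<longrightarrow> h \<circ> \<pi> \<in> A)}"
proof -
  have sub: "h permutes {1..n}" if "h permutes {i<..n}" for h
    using that by (rule permutes_subset) auto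
  have "sigma_algebra (sym_group n)
      {A. A \<subseteq> sym_group n \<and> (\<forall>h \<pi>. h permutes {i<..n} \<longrightarrow> \<pi> \<in> A \<longrightarrow> h \<circ> \<pi> \<in> A)}" (is "sigma_algebra _ ?S")
    unfolding sigma_algebra_iff2
  proof (intro conjI ballI allI impI)
    fix A assume A: "A \<in> ?S"
    \<comment> \<open>Complements stay invariant because \<open>inv h\<close> permutes the same
      set.\<close>
    have "h \<circ> \<pi> \<notin> A" if h: "h permutes {i<..n}" and "\<pi> \<notin> A" for h \<pi>
    proof
      assume "h \<circ> \<pi> \<in> A"
      then have "inv h \<circ> (h \<circ> \<pi>) \<in> A"
        using A permutes_inv[OF h] by blast
      then show False
        using \<open>\<pi> \<notin> A\<close> by (simp add: o_assoc permutes_inv_o[OF h])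
    qed
    then show "sym_group n - A \<in> ?S"
      using permutes_compose[OF _ sub] by auto
  next
    fix A :: "nat \<Rightarrow> (nat \<Rightarrow> nat) set" assume "range A \<subseteq> ?S"
    then show "(\<Union>i. A i) \<in> ?S" by fastforce
  qed auto
  then show ?thesis
    unfolding coset_algebra_def by (intro sigma_algebra.sets_measure_of_eq)
qed

text \<open>The coarser average is the mean of the finer one over translates by transpositions.
  These preserve every event of the coarser algebra, and summing over the whole group absorbs the
  translation.\<close>

lemma martingale_coset_avg:
  fixes f :: "(nat \<Rightarrow> nat) \<Rightarrow> 'e::banach"
  shows "martingale_upto n (unif_sym n) (coset_algebra n) (\<lambda>i. coset_avg {i<..n} f)"
  unfolding martingale_upto_def
proof (intro conjI allI impI ballI)
  fix i
  show "subalgebra (unif_sym n) (coset_algebra n i)"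
    by (auto simp: subalgebra_def sets_coset_algebra unif_sym_def space_uniform_count_measure sets_uniform_count_measure)
  have sub: "h permutes {1..n}" if "h permutes {i<..n}" for h
    using that by (rule permutes_subset) auto
  have sets: "coset_avg {i<..n} f -` X \<inter> sym_group n \<in> sets (coset_algebra n i)" for X
  proof -
    have "h \<circ> \<pi> \<in> coset_avg {i<..n} f -` X \<inter> sym_group n"
      if h: "h permutes {i<..n}" and \<pi>: "\<pi> \<in> coset_avg {i<..n} f -` X \<inter> sym_group n" for h \<pi>
      using \<pi> permutes_compose[of \<pi> "{1..n}", OF _ sub[OF h]] by (simp add: coset_avg_compose[OF h])
    then show ?thesis by (simp add: sets_coset_algebra)
  qed
  show "strongly_measurable (coset_algebra n i) (coset_avg {i<..n} f)"
    unfolding strongly_measurable_def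
  proof (intro conjI exI)
    show "coset_avg {i<..n} f \<in> borel_measurable (coset_algebra n i)"
      by (rule measurableI) (simp_all only: space_coset_algebra space_borel sets UNIV_I)
    show "countable (coset_avg {i<..n} f ` space (coset_algebra n i))"
      by (simp add: countable_finite finite_permutations)
  qed (rule closure_subset)
  show "lint_integrable (unif_sym n) (coset_avg {i<..n} f)"
    using has_lint_unif_sym unfolding lint_integrable_def by blast
next
  fix i j assume "i \<le> j \<and> j \<le> n"
  then have "h permutes {i<..n}" if "h permutes {j<..n}" for h
    by (intro permutes_subset[OF that]) auto
  then show "subalgebra (coset_algebra n j) (coset_algebra n i)"
    by (auto simp: subalgebra_def sets_coset_algebra)
next
  fix i A assume i: "i < n" and A: "A \<in> sets (coset_algebra n i)"
  let ?t = "Transposition.transpose (Suc i)"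
  let ?J = "insert (Suc i) {Suc i<..n}"
  let ?X = "coset_avg {Suc i<..n} f"
  have J: "Suc i \<in> {1..n}" using i by auto
  have tr: "?t j permutes {i<..n}" if "j \<in> ?J" for j
    using that i by (intro permutes_swap_id) auto
  have ind: "indicator A (?t j \<circ> \<pi>) = (indicator A \<pi> :: real)" if "j \<in> ?J" for j and \<pi> :: "nat \<Rightarrow> nat"
  proof -
    have closed: "?t j \<circ> \<rho> \<in> A" if "\<rho> \<in> A" for \<rho>
      using A tr[OF \<open>j \<in> ?J\<close>] that by (auto simp: sets_coset_algebra)
    have "?t j \<circ> (?t j \<circ> \<pi>) = \<pi>" by (simp add: o_assoc)
    then have "?t j \<circ> \<pi> \<in> A \<longleftrightarrow> \<pi> \<in> A"
      using closed[of \<pi>] closed[of "?t j \<circ> \<pi>"] by auto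
    then show ?thesis by (simp add: indicator_def)
  qed
  have "(\<Sum>\<pi>\<in>sym_group n. indicator A \<pi> *\<^sub>R coset_avg {i<..n} f \<pi>)
      = (\<Sum>\<pi>\<in>sym_group n. \<Sum>j\<in>?J. indicator A (?t j \<circ> \<pi>) *\<^sub>R ?X (?t j \<circ> \<pi>)) /\<^sub>R real (Suc (n - Suc i))"
    unfolding scaleR_sum_right
    using coset_avg_step[OF J, of f] ind
    by (intro sum.cong refl) (simp add: scaleR_sum_right mult.commute del: sum.insert of_nat_Suc)
  also have "\<dots> = (\<Sum>j\<in>?J. \<Sum>\<pi>\<in>sym_group n. indicator A (?t j \<circ> \<pi>) *\<^sub>R ?X (?t j \<circ> \<pi>)) /\<^sub>R real (Suc (n - Suc i))"
    by (subst sum.swap) (rule refl)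
  also have "\<dots> = (\<Sum>j\<in>?J. \<Sum>\<pi>\<in>sym_group n. indicator A \<pi> *\<^sub>R ?X \<pi>) /\<^sub>R real (Suc (n - Suc i))"
  proof -
    have "?t j permutes {1..n}" if "j \<in> ?J" for j
      using tr[OF that] by (rule permutes_subset) auto
    then show ?thesis
      by (intro arg_cong[where f="\<lambda>x. x /\<^sub>R _"] sum.cong refl
        sum_permutations_compose_left[where f="\<lambda>\<pi>. indicator A \<pi> *\<^sub>R ?X \<pi>"])
  qed
  also have "\<dots> = (\<Sum>\<pi>\<in>sym_group n. indicator A \<pi> *\<^sub>R ?X \<pi>)"
    by (simp add: sum_constant_scaleR del: sum.insert of_nat_Suc)
  finally show "lint (unif_sym n) (\<lambda>\<omega>. indicator A \<omega> *\<^sub>R ?X \<omega>) = lint (unif_sym n) (\<lambda>\<omega>. indicator A \<omega> *\<^sub>R coset_avg {i<..n} f \<omega>)"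
    by (simp add: lint_unif_sym)
qed

text \<open>Martingale type 2 for the coset averages, carried from the path space to the symmetric
  group by \<open>martingale_type_2_bound_any_space\<close>; the increments are bounded by
  \<open>coset_avg_increment\<close>.\<close>

lemma type_2_sym_group_le:
  fixes f :: "(nat \<Rightarrow> nat) \<Rightarrow> 'e::banach"
  assumes C: "martingale_type_2_bound C TYPE(nat \<Rightarrow> 'e) TYPE('e)"
  shows "(\<Sum>\<pi>\<in>sym_group n. (norm (f \<pi> - lint (unif_sym n) f))\<^sup>2) \<le> C\<^sup>2 * ordered_energy n f"
proof -
  let ?X = "\<lambda>i. coset_avg {i<..n} f"
  let ?D = "\<lambda>i. \<Sum>\<pi>\<in>sym_group n. (norm (?X i \<pi> - ?X (i - 1) \<pi>))\<^sup>2"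
  have "prob_space (unif_sym n)"
    unfolding unif_sym_def
    by (intro prob_space_uniform_count_measure finite_permutations) (auto intro: exI[of _ id] permutes_id)
  then have "(\<integral>\<^sup>+ \<pi>. ennreal ((norm (?X n \<pi> - ?X 0 \<pi>))\<^sup>2) \<partial>unif_sym n)
      \<le> ennreal (C\<^sup>2) * (\<Sum>i=1..n. \<integral>\<^sup>+ \<pi>. ennreal ((norm (?X i \<pi> - ?X (i - 1) \<pi>))\<^sup>2) \<partial>unif_sym n)"
    using martingale_type_2_bound_any_space[OF C, where 'w="nat \<Rightarrow> nat"] martingale_coset_avg[of n f]
    unfolding martingale_type_2_bound_def by blast
  also have "\<dots> = ennreal (C\<^sup>2 * (\<Sum>i=1..n. ?D i / fact n))"
    by (simp add: nn_integral_unif_sym ennreal_mult'' sum_nonneg divide_nonneg_nonneg)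
  finally have "(\<Sum>\<pi>\<in>sym_group n. (norm (?X n \<pi> - ?X 0 \<pi>))\<^sup>2) / fact n \<le> C\<^sup>2 * (\<Sum>i=1..n. ?D i / fact n)"
    by (subst (asm) nn_integral_unif_sym) (auto simp: ennreal_le_iff sum_nonneg divide_nonneg_nonneg)
  then have "(\<Sum>\<pi>\<in>sym_group n. (norm (?X n \<pi> - ?X 0 \<pi>))\<^sup>2) \<le> C\<^sup>2 * (\<Sum>i=1..n. ?D i)"
    by (simp add: sum_divide_distrib[symmetric] field_simps)
  also have "\<dots> \<le> C\<^sup>2 * ordered_energy n f"
    unfolding ordered_energy_def by (intro mult_left_mono sum_mono coset_avg_increment) auto
  \<comment> \<open>The endpoints: \<open>{n<..n}\<close> is empty, so \<open>?X n\<close> is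
    \<open>f\<close>, while \<open>?X 0\<close> averages over all of \<open>{1..n}\<close> and is
    the mean.\<close>
  also have "(\<Sum>\<pi>\<in>sym_group n. (norm (?X n \<pi> - ?X 0 \<pi>))\<^sup>2) = (\<Sum>\<pi>\<in>sym_group n. (norm (f \<pi> - lint (unif_sym n) f))\<^sup>2)"
    using coset_avg_full[of _ n f]
    by (intro sum.cong refl) (simp add: lint_unif_sym atLeastSucAtMost_greaterThanAtMost[symmetric])
  finally show ?thesis .
qed

section \<open>Entropy\<close>

text \<open>The left side has a double zero at \<open>t = 1\<close>, which permits a multiple of
  \<open>(t - 1)\<^sup>2\<close> near 1. Far from 1 the logarithm is paid for by
  \<open>ln m\<close>.\<close>

lemma sq_mult_ln_bound:
  fixes t m :: real
  assumes t: "0 \<le> t" "t \<le> m" and m: "2 \<le> m"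
  shows "2 * (t\<^sup>2 * ln t) - t\<^sup>2 + 1 \<le> 8 * ln m * (t - 1)\<^sup>2"
proof -
  \<comment> \<open>For \<open>t \<le> 2\<close> the factor \<open>1 + 2 * t\<close> is at most 5,
    so \<open>8 * ln m \<ge> 5\<close> is what is needed.\<close>
  have "ln (2::real) \<ge> 5 / 8"
    using ln2_ge_two_thirds by simp
  moreover have "ln 2 \<le> ln m"
    using m by simp
  ultimately have lm: "5 / 8 \<le> ln m" by linarith
  consider "t = 0" | "0 < t" "t \<le> 2" | "2 \<le> t"
    using t by linarith
  then show ?thesis
  proof cases
    case 1
    then show ?thesis using lm by simp
  next
    case 2
    have "t\<^sup>2 * ln t \<le> t\<^sup>2 * (t - 1)"
      using ln_le_minus_one[of t] 2 by (intro mult_left_mono) auto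
    then have "2 * (t\<^sup>2 * ln t) - t\<^sup>2 + 1 \<le> 2 * (t\<^sup>2 * (t - 1)) - t\<^sup>2 + 1"
      by simp
    also have "\<dots> = (1 + 2 * t) * (t - 1)\<^sup>2"
      by (simp add: power2_eq_square algebra_simps)
    also have "\<dots> \<le> (8 * ln m) * (t - 1)\<^sup>2"
      using 2 lm by (intro mult_right_mono) auto
    finally show ?thesis by simp
  next
    case 3
    have "1 \<le> t\<^sup>2" using 3 by (simp add: one_le_power)
    then have "2 * (t\<^sup>2 * ln t) - t\<^sup>2 + 1 \<le> 2 * (t\<^sup>2 * ln t)" by simp
    \<comment> \<open>Here \<open>t \<le> 2 * (t - 1)\<close>, whose square together with the factor
      2 gives the 8.\<close>
    also have "\<dots> \<le> 2 * ((2 * (t - 1))\<^sup>2 * ln m)"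
      using 3 t by (intro mult_left_mono mult_mono power_mono) auto
    also have "\<dots> = 8 * ln m * (t - 1)\<^sup>2"
      unfolding power_mult_distrib by simp
    finally show ?thesis .
  qed
qed

text \<open>Expanding around the mean \<open>c\<close>, the cross term vanishes because the
  deviations from \<open>c\<close> sum to 0.\<close>

lemma sum_sq_dev_mean_le:
  fixes x :: "'a \<Rightarrow> real"
  assumes J: "finite J" "J \<noteq> {}"
  shows "(\<Sum>j\<in>J. (x j - (\<Sum>j\<in>J. x j) / card J)\<^sup>2) \<le> (\<Sum>j\<in>J. (x j - a)\<^sup>2)"
proof -
  define c where "c = (\<Sum>j\<in>J. x j) / card J"
  have s: "(\<Sum>j\<in>J. x j - c) = 0"
    using J by (simp add: c_def sum_subtractf)
  have "(\<Sum>j\<in>J. (x j - a)\<^sup>2) = (\<Sum>j\<in>J. (x j - c)\<^sup>2 + 2 * (c - a) * (x j - c) + (c - a)\<^sup>2)"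
    by (intro sum.cong refl) (simp add: power2_eq_square algebra_simps)
  also have "\<dots> = (\<Sum>j\<in>J. (x j - c)\<^sup>2) + card J * (c - a)\<^sup>2"
    by (simp add: sum.distrib sum_distrib_left[symmetric] s)
  finally show ?thesis by (simp add: c_def)
qed

text \<open>Compare with the mean \<open>c\<close> of the \<open>x j\<close>: as \<open>x j \<le> card J * c\<close>, \<open>sq_mult_ln_bound\<close> applies to
  \<open>t = x j / c\<close>.\<close>

lemma entropy_finite_le:
  fixes x :: "'a \<Rightarrow> real"
  assumes J: "finite J" "J \<noteq> {}" and nn: "\<And>j. j \<in> J \<Longrightarrow> 0 \<le> x j"
  shows "(\<Sum>j\<in>J. (x j)\<^sup>2 * ln ((x j)\<^sup>2)) / card J - (\<Sum>j\<in>J. (x j)\<^sup>2) / card J * ln ((\<Sum>j\<in>J. (x j)\<^sup>2) / card J)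
    \<le> 8 * ln (card J) * ((\<Sum>j\<in>J. (x j - a)\<^sup>2) / card J)"
proof -
  define m where "m = real (card J)"
  define c where "c = (\<Sum>j\<in>J. x j) / m"
  define v where "v = (\<Sum>j\<in>J. (x j)\<^sup>2) / m"
  have card: "card J \<noteq> 0" using J by simp
  have m: "m \<ge> 1" using card by (simp add: m_def)
  have c0: "c \<ge> 0" and v0: "v \<ge> 0" using nn m by (auto simp: c_def v_def intro!: sum_nonneg divide_nonneg_nonneg)
  \<comment> \<open>If \<open>c = 0\<close> all \<open>x j\<close> vanish, and on one point the
    entropy is 0. Otherwise \<open>m \<ge> 2\<close>, as \<open>sq_mult_ln_bound\<close>
    demands.\<close>
  consider "c = 0" | "c > 0" "card J = 1" | "c > 0" "m \<ge> 2"
  proof -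
    have "card J = 1 \<or> 2 \<le> card J" using card by linarith
    then show thesis using c0 that by (fastforce simp: m_def)
  qed
  then have "(\<Sum>j\<in>J. (x j)\<^sup>2 * ln ((x j)\<^sup>2)) / m - v * ln v \<le> 8 * ln m * ((\<Sum>j\<in>J. (x j - a)\<^sup>2) / m)"
  proof cases
    case 1
    then have "\<And>j. j \<in> J \<Longrightarrow> x j = 0"
      using m nn J by (simp add: c_def sum_nonneg_eq_0_iff)
    then show ?thesis using m by (simp add: v_def)
  next
    case 2
    then obtain k where "J = {k}" by (auto simp: card_1_singleton_iff)
    then show ?thesis by (simp add: v_def m_def)
  next
    case 3
    have xm: "x j \<le> m * c" if "j \<in> J" for j
      using member_le_sum[of j J x] that nn J m by (simp add: c_def)
    have pt: "(x j)\<^sup>2 * ln ((x j)\<^sup>2) - (x j)\<^sup>2 * ln (c\<^sup>2) - (x j)\<^sup>2 + c\<^sup>2 \<le> 8 * ln m * (x j - c)\<^sup>2" if j: "j \<in> J" for j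
    proof -
      let ?t = "x j / c"
      have "2 * (?t\<^sup>2 * ln ?t) - ?t\<^sup>2 + 1 \<le> 8 * ln m * (?t - 1)\<^sup>2"
        using 3 nn[OF j] xm[OF j] by (intro sq_mult_ln_bound) (auto simp: field_simps)
      then have "c\<^sup>2 * (2 * (?t\<^sup>2 * ln ?t) - ?t\<^sup>2 + 1) \<le> c\<^sup>2 * (8 * ln m * (?t - 1)\<^sup>2)"
        by (rule mult_left_mono) simp
      moreover have "c\<^sup>2 * (8 * ln m * (?t - 1)\<^sup>2) = 8 * ln m * (x j - c)\<^sup>2"
      proof -
        have "x j - c = c * (?t - 1)" using 3 by (simp add: field_simps)
        then show ?thesis by (simp add: power_mult_distrib)
      qed
      moreover have "c\<^sup>2 * (2 * (?t\<^sup>2 * ln ?t) - ?t\<^sup>2 + 1) = (x j)\<^sup>2 * ln ((x j)\<^sup>2) - (x j)\<^sup>2 * ln (c\<^sup>2) - (x j)\<^sup>2 + c\<^sup>2"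
      proof (cases "x j = 0")
        case False
        then have lns: "ln ?t = ln (x j) - ln c" "ln ((x j)\<^sup>2) = 2 * ln (x j)" "ln (c\<^sup>2) = 2 * ln c"
          using 3 nn[OF j] by (auto simp: ln_div ln_realpow)
        have ct: "c\<^sup>2 * ?t\<^sup>2 = (x j)\<^sup>2"
          using 3 by (simp add: power_divide)
        have "c\<^sup>2 * (2 * (?t\<^sup>2 * ln ?t) - ?t\<^sup>2 + 1) = 2 * (c\<^sup>2 * ?t\<^sup>2 * ln ?t) - c\<^sup>2 * ?t\<^sup>2 + c\<^sup>2"
          by (simp only: algebra_simps)
        then show ?thesis unfolding ct lns by (simp add: algebra_simps)
      qed simp
      ultimately show ?thesis by simp
    qed
    have "v > 0"
    proof -
      have "\<exists>j\<in>J. x j \<noteq> 0" using 3 by (metis c_def divide_eq_0_iff less_irrefl sum.neutral)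
      then have "(\<Sum>j\<in>J. (x j)\<^sup>2) > 0" using J(1)
        by (metis (mono_tags, lifting) sum_pos2 zero_le_power2 zero_less_power2)
      then show ?thesis using m by (simp add: v_def)
    qed
    \<comment> \<open>\<open>ln u \<le> u - 1\<close> at \<open>u = c\<^sup>2 / v\<close> allows
      \<open>c\<^sup>2\<close> as reference value instead of \<open>v\<close>: the entropy is then
      at most the mean of the left sides of \<open>pt\<close>.\<close>
    have "v * (ln (c\<^sup>2) - ln v) \<le> v * (c\<^sup>2 / v - 1)"
      using \<open>v > 0\<close> 3 ln_le_minus_one[of "c\<^sup>2 / v"] by (intro mult_left_mono) (auto simp: ln_div)
    also have "\<dots> = c\<^sup>2 - v" using \<open>v > 0\<close> by (simp add: field_simps)
    finally have gv: "v * ln (c\<^sup>2) + v - c\<^sup>2 \<le> v * ln v" by (simp add: algebra_simps)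
    have "(\<Sum>j\<in>J. (x j)\<^sup>2 * ln ((x j)\<^sup>2)) / m - v * ln v
        \<le> (\<Sum>j\<in>J. (x j)\<^sup>2 * ln ((x j)\<^sup>2)) / m - (v * ln (c\<^sup>2) + v - c\<^sup>2)"
      using gv by simp
    also have "\<dots> = (\<Sum>j\<in>J. (x j)\<^sup>2 * ln ((x j)\<^sup>2) - (x j)\<^sup>2 * ln (c\<^sup>2) - (x j)\<^sup>2 + c\<^sup>2) / m"
      using m unfolding v_def
      by (simp add: sum.distrib sum_subtractf sum_distrib_right[symmetric] add_divide_distrib diff_divide_distrib m_def[symmetric])
    also have "\<dots> \<le> (\<Sum>j\<in>J. 8 * ln m * (x j - c)\<^sup>2) / m"
      using m by (intro divide_right_mono sum_mono pt) auto
    also have "\<dots> = 8 * ln m * ((\<Sum>j\<in>J. (x j - c)\<^sup>2) / m)"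
      by (simp add: sum_distrib_left)
    \<comment> \<open>The mean minimises the squared deviation, so any \<open>a\<close> may replace
      \<open>c\<close>.\<close>
    also have "\<dots> \<le> 8 * ln m * ((\<Sum>j\<in>J. (x j - a)\<^sup>2) / m)"
      using sum_sq_dev_mean_le[OF J, of x a] m unfolding c_def m_def
      by (intro mult_left_mono divide_right_mono) auto
    finally show ?thesis .
  qed
  then show ?thesis by (simp add: m_def v_def)
qed

section \<open>Entropy along the coset filtration\<close>

text \<open>\<open>N (i - 1)\<close> is the mean of \<open>N i\<close> over \<open>n - i + 1\<close>
  translates, so after summing over the group the difference is a sum of entropies on that many
  points.\<close>

lemma entropy_increment:
  fixes g :: "(nat \<Rightarrow> nat) \<Rightarrow> real"
  assumes i: "i \<in> {1..n}"
  defines "N \<equiv> \<lambda>i. coset_avg {i<..n} (\<lambda>\<pi>. (g \<pi>)\<^sup>2)"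
  shows "(\<Sum>\<pi>\<in>sym_group n. N i \<pi> * ln (N i \<pi>)) - (\<Sum>\<pi>\<in>sym_group n. N (i - 1) \<pi> * ln (N (i - 1) \<pi>))
    \<le> 8 * ln (real (Suc (n - i))) * ((\<Sum>j\<in>{i<..n}. transp_energy n g i j) / real (Suc (n - i)))"
proof -
  let ?S = "{i<..n}" and ?m = "real (Suc (n - i))"
  let ?t = "Transposition.transpose i"
  let ?G = "sym_group n"
  let ?d = "\<lambda>\<pi>. \<Sum>j\<in>?S. (\<Sum>h | h permutes ?S. (g (h \<circ> \<pi>) - g (h \<circ> (?t j \<circ> \<pi>)))\<^sup>2) / fact (card ?S)"
  have N0: "N i \<pi> \<ge> 0" for i \<pi>
    by (simp add: N_def coset_avg_def sum_nonneg)
  have card: "card (insert i ?S) = Suc (n - i)" by simp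
  have step: "N (i - 1) \<pi> = (\<Sum>j\<in>insert i ?S. N i (?t j \<circ> \<pi>)) / ?m" for \<pi>
    unfolding N_def coset_avg_step[OF i] by (simp add: field_simps del: sum.insert of_nat_Suc)
  have pt: "(\<Sum>j\<in>insert i ?S. N i (?t j \<circ> \<pi>) * ln (N i (?t j \<circ> \<pi>))) / ?m - N (i - 1) \<pi> * ln (N (i - 1) \<pi>)
      \<le> 8 * ln ?m * (?d \<pi> / ?m)" for \<pi>
  proof -
    \<comment> \<open>The entropy bound is taken for square roots, with \<open>a\<close> their value
      at \<open>j = i\<close>; this term then contributes 0.\<close>
    have "(\<Sum>j\<in>insert i ?S. N i (?t j \<circ> \<pi>) * ln (N i (?t j \<circ> \<pi>))) / ?m - N (i - 1) \<pi> * ln (N (i - 1) \<pi>)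
        \<le> 8 * ln ?m * ((\<Sum>j\<in>insert i ?S. (sqrt (N i (?t j \<circ> \<pi>)) - sqrt (N i \<pi>))\<^sup>2) / ?m)"
      using entropy_finite_le[of "insert i ?S" "\<lambda>j. sqrt (N i (?t j \<circ> \<pi>))" "sqrt (N i \<pi>)"]
      unfolding card step by (simp add: N0 del: sum.insert of_nat_Suc)
    also have "\<dots> = 8 * ln ?m * ((\<Sum>j\<in>?S. (sqrt (N i \<pi>) - sqrt (N i (?t j \<circ> \<pi>)))\<^sup>2) / ?m)"
      by (simp add: power2_commute)
    also have "\<dots> \<le> 8 * ln ?m * (?d \<pi> / ?m)"
    proof (intro mult_left_mono divide_right_mono sum_mono)
      fix j
      show "(sqrt (N i \<pi>) - sqrt (N i (?t j \<circ> \<pi>)))\<^sup>2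
          \<le> (\<Sum>h | h permutes ?S. (g (h \<circ> \<pi>) - g (h \<circ> (?t j \<circ> \<pi>)))\<^sup>2) / fact (card ?S)"
        using sqrt_mean_square_diff_le[of "fact (card ?S)" "\<lambda>h. g (h \<circ> \<pi>)" "{h. h permutes ?S}" "\<lambda>h. g (h \<circ> (?t j \<circ> \<pi>))"]
        by (simp add: N_def coset_avg_def divide_inverse mult.commute)
    qed auto
    finally show ?thesis .
  qed
  have inv: "(\<Sum>\<pi>\<in>?G. N i (?t j \<circ> \<pi>) * ln (N i (?t j \<circ> \<pi>))) = (\<Sum>\<pi>\<in>?G. N i \<pi> * ln (N i \<pi>))"
    if "j \<in> insert i ?S" for j
    by (rule sum_permutations_compose_left[of "?t j", where f="\<lambda>\<pi>. N i \<pi> * ln (N i \<pi>)"])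
      (use that i in \<open>auto intro!: permutes_swap_id\<close>)
  have "(\<Sum>\<pi>\<in>?G. (\<Sum>j\<in>insert i ?S. N i (?t j \<circ> \<pi>) * ln (N i (?t j \<circ> \<pi>))) / ?m)
      = (\<Sum>j\<in>insert i ?S. \<Sum>\<pi>\<in>?G. N i (?t j \<circ> \<pi>) * ln (N i (?t j \<circ> \<pi>))) / ?m"
    unfolding sum_divide_distrib[symmetric] by (subst sum.swap) (rule refl)
  also have "\<dots> = (\<Sum>j\<in>insert i ?S. \<Sum>\<pi>\<in>?G. N i \<pi> * ln (N i \<pi>)) / ?m"
    by (intro arg_cong[where f="\<lambda>x. x / _"] sum.cong refl inv)
  also have "\<dots> = (\<Sum>\<pi>\<in>?G. N i \<pi> * ln (N i \<pi>))"
    using card by (simp del: sum.insert of_nat_Suc card_insert_disjoint)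
  finally have eq: "(\<Sum>\<pi>\<in>?G. N i \<pi> * ln (N i \<pi>))
      = (\<Sum>\<pi>\<in>?G. (\<Sum>j\<in>insert i ?S. N i (?t j \<circ> \<pi>) * ln (N i (?t j \<circ> \<pi>))) / ?m)" by simp
  have "(\<Sum>\<pi>\<in>?G. N i \<pi> * ln (N i \<pi>)) - (\<Sum>\<pi>\<in>?G. N (i - 1) \<pi> * ln (N (i - 1) \<pi>))
      \<le> (\<Sum>\<pi>\<in>?G. 8 * ln ?m * (?d \<pi> / ?m))"
    unfolding eq sum_subtractf[symmetric] by (intro sum_mono pt)
  also have "\<dots> = 8 * ln ?m * ((\<Sum>\<pi>\<in>?G. ?d \<pi>) / ?m)"
    by (simp add: sum_distrib_left sum_divide_distrib)
  also have "(\<Sum>\<pi>\<in>?G. ?d \<pi>) = (\<Sum>j\<in>?S. transp_energy n g i j)"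
    unfolding transp_energy_def real_norm_def power2_abs
    using i by (subst sum.swap, subst sum_transposition_pairs_coset[where F="\<lambda>\<pi> \<rho>. (g \<pi> - g \<rho>)\<^sup>2"]) auto
  finally show ?thesis .
qed

text \<open>\<open>T n - T 0\<close> telescopes into the increments of
  \<open>entropy_increment\<close>, whose logarithms are all at most \<open>ln n\<close>.\<close>

lemma entropy_sym_group_le:
  fixes g :: "(nat \<Rightarrow> nat) \<Rightarrow> real"
  assumes n: "n \<ge> 1"
  defines "V \<equiv> (\<Sum>\<pi>\<in>sym_group n. (g \<pi>)\<^sup>2) / fact n"
  shows "(\<Sum>\<pi>\<in>sym_group n. (g \<pi>)\<^sup>2 * ln ((g \<pi>)\<^sup>2)) - fact n * (V * ln V) \<le> 8 * ln (real n) * ordered_energy n g"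
proof -
  define N where "N = (\<lambda>i. coset_avg {i<..n} (\<lambda>\<pi>. (g \<pi>)\<^sup>2))"
  define T where "T i = (\<Sum>\<pi>\<in>sym_group n. N i \<pi> * ln (N i \<pi>))" for i
  have "T n = (\<Sum>\<pi>\<in>sym_group n. (g \<pi>)\<^sup>2 * ln ((g \<pi>)\<^sup>2))"
    by (simp add: T_def N_def)
  moreover have "T 0 = fact n * (V * ln V)"
  proof -
    have "N 0 \<pi> = V" if "\<pi> permutes {1..n}" for \<pi>
      using coset_avg_full[OF that, of "\<lambda>\<pi>. (g \<pi>)\<^sup>2"]
      by (simp add: N_def V_def atLeastSucAtMost_greaterThanAtMost[symmetric] divide_inverse mult.commute)
    then have "T 0 = (\<Sum>\<pi>\<in>sym_group n. V * ln V)"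
      unfolding T_def by (intro sum.cong) auto
    then show ?thesis
      by (simp add: card_permutations[OF refl])
  qed
  moreover have "T n - T 0 = (\<Sum>i=1..n. T i - T (i - 1))"
    by (induction n) auto
  moreover have "(\<Sum>i=1..n. T i - T (i - 1)) \<le> (\<Sum>i=1..n. 8 * ln (real n) * ((\<Sum>j\<in>{i<..n}. transp_energy n g i j) / real (Suc (n - i))))"
  proof (rule sum_mono)
    fix i assume i: "i \<in> {1..n}"
    have "T i - T (i - 1) \<le> 8 * ln (real (Suc (n - i))) * ((\<Sum>j\<in>{i<..n}. transp_energy n g i j) / real (Suc (n - i)))"
      unfolding T_def N_def by (rule entropy_increment[OF i])
    also have "\<dots> \<le> 8 * ln (real n) * ((\<Sum>j\<in>{i<..n}. transp_energy n g i j) / real (Suc (n - i)))"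
      using i by (intro mult_right_mono divide_nonneg_nonneg sum_nonneg transp_energy_nonneg) auto
    finally show "T i - T (i - 1) \<le> 8 * ln (real n) * ((\<Sum>j\<in>{i<..n}. transp_energy n g i j) / real (Suc (n - i)))" .
  qed
  ultimately show ?thesis
    by (simp add: ordered_energy_def sum_distrib_left)
qed

section \<open>Averaging over the order of revelation\<close>

text \<open>Double transitivity: for uniform \<open>\<sigma>\<close> the pair
  \<open>(\<sigma> i, \<sigma> j)\<close> is uniform on the \<open>n * (n - 1)\<close> ordered pairs
  of distinct points.\<close>

lemma sum_permutations_pair:
  fixes D :: "nat \<Rightarrow> nat \<Rightarrow> real"
  assumes ij: "i \<in> {1..n}" "j \<in> {1..n}" "i \<noteq> j"
  shows "(\<Sum>\<sigma>\<in>sym_group n. D (\<sigma> i) (\<sigma> j)) * (real n * (real n - 1)) =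
    fact n * (\<Sum>p\<in>{(a, b). a \<in> {1..n} \<and> b \<in> {1..n} \<and> a \<noteq> b}. D (fst p) (snd p))"
proof -
  let ?P = "{(a, b). a \<in> {1..n} \<and> b \<in> {1..n} \<and> a \<noteq> b}"
  let ?s = "\<lambda>a b. \<Sum>\<sigma>\<in>sym_group n. D (\<sigma> a) (\<sigma> b)"
  have P: "?P = (SIGMA a:{1..n}. {1..n} - {a})" by auto
  have card: "real (card ?P) = real n * (real n - 1)"
    unfolding P using ij by (subst card_SigmaI) (auto simp: of_nat_diff)
  have const: "?s a b = ?s i j" if ab: "a \<in> {1..n}" "b \<in> {1..n}" "a \<noteq> b" for a b
  proof -
    \<comment> \<open>\<open>\<rho>\<close> takes \<open>i\<close> to \<open>a\<close> and
      \<open>j\<close> to \<open>b\<close>: swap \<open>i\<close> with \<open>a\<close>, then move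
      the image of \<open>j\<close> to \<open>b\<close>. That image differs from \<open>a\<close>,
      so the second swap fixes \<open>a\<close>.\<close>
    define \<rho> where "\<rho> = Transposition.transpose b (Transposition.transpose i a j) \<circ> Transposition.transpose i a"
    have j': "Transposition.transpose i a j = (if j = a then i else j)"
      using ij by (simp add: Transposition.transpose_def)
    have in1: "Transposition.transpose i a j \<in> {1..n}" and ne: "Transposition.transpose i a j \<noteq> a"
      unfolding j' using ij by auto
    have \<rho>: "\<rho> permutes {1..n}" "\<rho> i = a" "\<rho> j = b"
      unfolding \<rho>_def using ij ab in1 ne ne[symmetric]
      by (auto intro!: permutes_compose permutes_swap_id simp only: simp_thms o_apply transpose_apply_other
        transpose_apply_first transpose_apply_second)
    show ?thesis
      using sum_permutations_compose_right[OF \<rho>(1), of "\<lambda>\<sigma>. D (\<sigma> i) (\<sigma> j)"] by (simp only: o_apply \<rho>(2,3))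
  qed
  have perm: "(\<Sum>p\<in>?P. D (\<sigma> (fst p)) (\<sigma> (snd p))) = (\<Sum>p\<in>?P. D (fst p) (snd p))" if \<sigma>: "\<sigma> permutes {1..n}" for \<sigma>
  proof -
    \<comment> \<open>Setting the diagonal to 0 gives a double sum over a full square, which can be
      reindexed one coordinate at a time.\<close>
    define E where "E a b = (if a = b then 0 else D a b)" for a b
    have P_sum: "(\<Sum>p\<in>?P. F (fst p) (snd p)) = (\<Sum>a\<in>{1..n}. \<Sum>b\<in>{1..n}. if a = b then 0 else F a b)" for F :: "nat \<Rightarrow> nat \<Rightarrow> real"
    proof -
      have "(\<Sum>p\<in>?P. F (fst p) (snd p)) = (\<Sum>a\<in>{1..n}. \<Sum>b\<in>{1..n} - {a}. F a b)"
        unfolding P by (subst sum.Sigma) (auto simp: case_prod_beta)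
      also have "\<dots> = (\<Sum>a\<in>{1..n}. \<Sum>b\<in>{1..n}. if a = b then 0 else F a b)"
        by (intro sum.cong refl sum.mono_neutral_cong_left) auto
      finally show ?thesis .
    qed
    have "(\<Sum>p\<in>?P. D (\<sigma> (fst p)) (\<sigma> (snd p))) = (\<Sum>a\<in>{1..n}. \<Sum>b\<in>{1..n}. E (\<sigma> a) (\<sigma> b))"
      unfolding P_sum[of "\<lambda>a b. D (\<sigma> a) (\<sigma> b)"] E_def inj_eq[OF permutes_inj[OF \<sigma>]] ..
    also have "\<dots> = (\<Sum>a\<in>{1..n}. \<Sum>b\<in>{1..n}. E (\<sigma> a) b)"
      by (intro sum.cong refl sum.reindex_bij_betw permutes_imp_bij[OF \<sigma>])
    also have "\<dots> = (\<Sum>a\<in>{1..n}. \<Sum>b\<in>{1..n}. E a b)"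
      by (rule sum.reindex_bij_betw[OF permutes_imp_bij[OF \<sigma>]])
    also have "\<dots> = (\<Sum>p\<in>?P. D (fst p) (snd p))"
      unfolding P_sum E_def ..
    finally show ?thesis .
  qed
  have "?s i j * (real n * (real n - 1)) = (\<Sum>p\<in>?P. ?s i j)"
    by (simp add: card[symmetric])
  also have "\<dots> = (\<Sum>p\<in>?P. ?s (fst p) (snd p))"
    by (intro sum.cong refl const[symmetric]) auto
  also have "\<dots> = (\<Sum>\<sigma>\<in>sym_group n. \<Sum>p\<in>?P. D (\<sigma> (fst p)) (\<sigma> (snd p)))"
    by (rule sum.swap)
  also have "\<dots> = (\<Sum>\<sigma>\<in>sym_group n. \<Sum>p\<in>?P. D (fst p) (snd p))"
    by (intro sum.cong refl perm) simp
  also have "\<dots> = fact n * (\<Sum>p\<in>?P. D (fst p) (snd p))"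
    by (simp add: card_permutations[OF refl])
  finally show ?thesis .
qed

text \<open>Each transposition comes from two ordered pairs; its support recovers the pair with
  \<open>a < b\<close>.\<close>

lemma sum_transpositions:
  fixes F :: "(nat \<Rightarrow> nat) \<Rightarrow> real"
  shows "(\<Sum>p\<in>{(a, b). a \<in> {1..n} \<and> b \<in> {1..n} \<and> a \<noteq> b}. F (Transposition.transpose (fst p) (snd p)))
    = 2 * (\<Sum>\<tau>\<in>transpositions n. F \<tau>)"
proof -
  let ?L = "{(a, b). a \<in> {1..n} \<and> b \<in> {1..n} \<and> a < b}"
  let ?U = "{(a, b). a \<in> {1..n} \<and> b \<in> {1..n} \<and> b < a}"
  let ?T = "\<lambda>p. Transposition.transpose (fst p) (snd p :: nat)"
  have fin: "finite ?L" "finite ?U"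
    by (auto intro: finite_subset[of _ "{1..n} \<times> {1..n}"])
  have "(\<Sum>p\<in>{(a, b). a \<in> {1..n} \<and> b \<in> {1..n} \<and> a \<noteq> b}. F (?T p)) = (\<Sum>p\<in>?L \<union> ?U. F (?T p))"
    by (rule sum.cong) auto
  also have "\<dots> = (\<Sum>p\<in>?L. F (?T p)) + (\<Sum>p\<in>?U. F (?T p))"
    by (rule sum.union_disjoint[OF fin]) auto
  also have "(\<Sum>p\<in>?U. F (?T p)) = (\<Sum>p\<in>?L. F (?T p))"
    by (rule sum.reindex_bij_witness[where i=prod.swap and j=prod.swap]) (auto simp: transpose_commute)
  also have "(\<Sum>p\<in>?L. F (?T p)) = (\<Sum>\<tau>\<in>?T ` ?L. F \<tau>)"
  proof (rule sum.reindex[symmetric, unfolded o_def])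
    show "inj_on ?T ?L"
    proof (rule inj_onI)
      fix p q assume pq: "p \<in> ?L" "q \<in> ?L" and eq: "?T p = ?T q"
      have supp: "{fst r, snd r} = {x. ?T r x \<noteq> x}" if "r \<in> ?L" for r
        using that by (auto simp: transpose_eq_iff)
      have "{fst p, snd p} = {fst q, snd q}"
        unfolding supp[OF pq(1)] supp[OF pq(2)] eq ..
      then show "p = q" using pq by (auto simp: doubleton_eq_iff)
    qed
  qed
  also have "?T ` ?L = transpositions n"
  proof -
    have "Transposition.transpose a b \<in> ?T ` ?L" if "a \<in> {1..n}" "b \<in> {1..n}" "a \<noteq> b" for a b
    proof (cases "a < b")
      case True
      then show ?thesis using that by (intro image_eqI[of _ _ "(a, b)"]) auto
    next
      case False
      then show ?thesis using that by (intro image_eqI[of _ _ "(b, a)"]) (auto simp: transpose_commute)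
    qed
    then show ?thesis by (fastforce simp: transpositions_def)
  qed
  finally show ?thesis by simp
qed

section \<open>The energy averaged over all orders\<close>

text \<open>Unnormalised: \<open>fact n\<close> times the sum of integrals in the theorem.\<close>

definition total_energy :: "nat \<Rightarrow> ((nat \<Rightarrow> nat) \<Rightarrow> 'e::real_normed_vector) \<Rightarrow> real" where
  "total_energy n f = (\<Sum>\<tau>\<in>transpositions n. \<Sum>\<pi>\<in>sym_group n. (norm (f \<pi> - f (\<tau> \<circ> \<pi>)))\<^sup>2)"

lemma sum_ordered_energy:
  fixes f :: "(nat \<Rightarrow> nat) \<Rightarrow> 'e::real_normed_vector"
  assumes n: "n \<ge> 2"
  shows "(\<Sum>\<sigma>\<in>sym_group n. ordered_energy n (\<lambda>\<pi>. f (\<sigma> \<circ> \<pi>))) \<le> fact n * (2 / (real n - 1) * total_energy n f)"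
proof -
  let ?P = "{(a, b). a \<in> {1..n} \<and> b \<in> {1..n} \<and> a \<noteq> b}"
  \<comment> \<open>By double transitivity \<open>K\<close> is the sum over \<open>\<sigma>\<close>
    of the energy of any one pair. The 2 reflects the two ordered pairs per transposition.\<close>
  define K where "K = fact n * (2 * total_energy n f) / (real n * (real n - 1))"
  have nn: "real n * (real n - 1) > 0" using n by simp
  have te: "total_energy n f \<ge> 0"
    by (simp add: total_energy_def sum_nonneg)
  \<comment> \<open>Translating \<open>f\<close> by \<open>\<sigma>\<close> conjugates the
    transposition.\<close>
  have sh: "transp_energy n (\<lambda>\<pi>. f (\<sigma> \<circ> \<pi>)) i j = transp_energy n f (\<sigma> i) (\<sigma> j)" if \<sigma>: "\<sigma> permutes {1..n}" for \<sigma> i j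
  proof -
    have "\<sigma> \<circ> (Transposition.transpose i j \<circ> \<pi>) = Transposition.transpose (\<sigma> i) (\<sigma> j) \<circ> (\<sigma> \<circ> \<pi>)" for \<pi> :: "nat \<Rightarrow> nat"
      using transpose_comp_eq[OF permutes_bij[OF \<sigma>], of "\<sigma> i" "\<sigma> j"]
      by (metis \<sigma> fun.map_comp permutes_inverses(2))
    then show ?thesis
      unfolding transp_energy_def
      using sum_permutations_compose_left[OF \<sigma>, of "\<lambda>\<pi>. (norm (f \<pi> - f (Transposition.transpose (\<sigma> i) (\<sigma> j) \<circ> \<pi>)))\<^sup>2"]
      by simp
  qed
  have K: "(\<Sum>\<sigma>\<in>sym_group n. transp_energy n f (\<sigma> i) (\<sigma> j)) = K" if "i \<in> {1..n}" "j \<in> {1..n}" "i \<noteq> j" for i j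
  proof -
    have "(\<Sum>p\<in>?P. transp_energy n f (fst p) (snd p)) = 2 * total_energy n f"
      using sum_transpositions[of "\<lambda>\<tau>. \<Sum>\<pi>\<in>sym_group n. (norm (f \<pi> - f (\<tau> \<circ> \<pi>)))\<^sup>2" n]
      by (simp add: transp_energy_def total_energy_def)
    then show ?thesis
      using sum_permutations_pair[OF that, of "transp_energy n f"] nn
      unfolding K_def by (subst nonzero_eq_divide_eq) (simp_all only: mult.assoc order_less_imp_not_eq2 refl not_False_eq_True)
  qed
  have K0: "K \<ge> 0" unfolding K_def using te nn by (intro divide_nonneg_pos) auto
  have "(\<Sum>\<sigma>\<in>sym_group n. ordered_energy n (\<lambda>\<pi>. f (\<sigma> \<circ> \<pi>)))
      = (\<Sum>\<sigma>\<in>sym_group n. \<Sum>i=1..n. (\<Sum>j\<in>{i<..n}. transp_energy n f (\<sigma> i) (\<sigma> j)) / real (Suc (n - i)))"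
    unfolding ordered_energy_def by (intro sum.cong refl) (simp add: sh)
  also have "\<dots> = (\<Sum>i=1..n. \<Sum>\<sigma>\<in>sym_group n. (\<Sum>j\<in>{i<..n}. transp_energy n f (\<sigma> i) (\<sigma> j)) / real (Suc (n - i)))"
    by (rule sum.swap)
  also have "\<dots> = (\<Sum>i=1..n. (\<Sum>j\<in>{i<..n}. \<Sum>\<sigma>\<in>sym_group n. transp_energy n f (\<sigma> i) (\<sigma> j)) / real (Suc (n - i)))"
    unfolding sum_divide_distrib[symmetric] by (intro sum.cong refl arg_cong[where f="\<lambda>x. x / _"] sum.swap)
  also have "\<dots> = (\<Sum>i=1..n. (\<Sum>j\<in>{i<..n}. K) / real (Suc (n - i)))"
    by (intro sum.cong refl arg_cong[where f="\<lambda>x. x / _"] K) auto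
  \<comment> \<open>There are \<open>n - i\<close> terms over \<open>n - i + 1\<close>, so each
    \<open>i\<close> costs at most \<open>K\<close>.\<close>
  also have "\<dots> \<le> (\<Sum>i=1..n. K)"
    using K0 by (intro sum_mono) (simp add: field_simps)
  also have "\<dots> = fact n * (2 / (real n - 1) * total_energy n f)"
    using n by (simp add: K_def field_simps)
  finally show ?thesis .
qed

lemma le_total_energyI:
  fixes f :: "(nat \<Rightarrow> nat) \<Rightarrow> 'e::real_normed_vector"
  assumes n: "n \<ge> 2" and c: "c \<ge> 0"
    and le: "\<And>\<sigma>. \<sigma> permutes {1..n} \<Longrightarrow> a \<le> c * ordered_energy n (\<lambda>\<pi>. f (\<sigma> \<circ> \<pi>))"
  shows "a \<le> c * (2 / (real n - 1) * total_energy n f)"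
proof -
  have "fact n * a = (\<Sum>\<sigma>\<in>sym_group n. a)"
    by (simp add: card_permutations[OF refl])
  also have "\<dots> \<le> (\<Sum>\<sigma>\<in>sym_group n. c * ordered_energy n (\<lambda>\<pi>. f (\<sigma> \<circ> \<pi>)))"
    by (intro sum_mono le) simp
  also have "\<dots> \<le> c * (fact n * (2 / (real n - 1) * total_energy n f))"
    unfolding sum_distrib_left[symmetric] by (intro mult_left_mono c sum_ordered_energy n)
  finally have "fact n * a \<le> fact n * (c * (2 / (real n - 1) * total_energy n f))"
    by (simp only: mult_ac)
  then show ?thesis
    by (subst (asm) mult_le_cancel_left_pos) simp_all
qed

section \<open>Variance and entropy against the total energy\<close>

text \<open>Mean and variance are unchanged by translating \<open>f\<close> by
  \<open>\<sigma>\<close>, so the ordered bound may be averaged over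
  \<open>\<sigma>\<close>.\<close>

lemma poincare_total_energy:
  fixes f :: "(nat \<Rightarrow> nat) \<Rightarrow> 'e::banach"
  assumes C: "martingale_type_2_bound C TYPE(nat \<Rightarrow> 'e) TYPE('e)" and n: "n \<ge> 2"
  shows "(\<Sum>\<pi>\<in>sym_group n. (norm (f \<pi> - lint (unif_sym n) f))\<^sup>2) \<le> C\<^sup>2 * (2 / (real n - 1) * total_energy n f)"
proof (rule le_total_energyI[OF n])
  fix \<sigma> assume \<sigma>: "\<sigma> permutes {1..n}"
  have "lint (unif_sym n) (\<lambda>\<pi>. f (\<sigma> \<circ> \<pi>)) = lint (unif_sym n) f"
    unfolding lint_unif_sym by (simp only: sum_permutations_compose_left[OF \<sigma>, of f])
  then show "(\<Sum>\<pi>\<in>sym_group n. (norm (f \<pi> - lint (unif_sym n) f))\<^sup>2) \<le> C\<^sup>2 * ordered_energy n (\<lambda>\<pi>. f (\<sigma> \<circ> \<pi>))"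
    using type_2_sym_group_le[OF C, where n=n and f="\<lambda>\<pi>. f (\<sigma> \<circ> \<pi>)"]
      sum_permutations_compose_left[OF \<sigma>, of "\<lambda>\<pi>. (norm (f \<pi> - lint (unif_sym n) f))\<^sup>2"] by simp
qed simp

lemma log_sobolev_total_energy:
  fixes g :: "(nat \<Rightarrow> nat) \<Rightarrow> real"
  assumes n: "n \<ge> 2"
  defines "V \<equiv> (\<Sum>\<pi>\<in>sym_group n. (g \<pi>)\<^sup>2) / fact n"
  shows "(\<Sum>\<pi>\<in>sym_group n. (g \<pi>)\<^sup>2 * ln ((g \<pi>)\<^sup>2)) - fact n * (V * ln V)
    \<le> 8 * ln (real n) * (2 / (real n - 1) * total_energy n g)"
proof (rule le_total_energyI[OF n])
  fix \<sigma> assume \<sigma>: "\<sigma> permutes {1..n}"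
  show "(\<Sum>\<pi>\<in>sym_group n. (g \<pi>)\<^sup>2 * ln ((g \<pi>)\<^sup>2)) - fact n * (V * ln V) \<le> 8 * ln (real n) * ordered_energy n (\<lambda>\<pi>. g (\<sigma> \<circ> \<pi>))"
    using entropy_sym_group_le[of n "\<lambda>\<pi>. g (\<sigma> \<circ> \<pi>)"] n
      sum_permutations_compose_left[OF \<sigma>, of "\<lambda>\<pi>. (g \<pi>)\<^sup>2"]
      sum_permutations_compose_left[OF \<sigma>, of "\<lambda>\<pi>. (g \<pi>)\<^sup>2 * ln ((g \<pi>)\<^sup>2)"] by (simp add: V_def)
qed (use n in simp)

section \<open>The Orlicz norm\<close>

text \<open>Gibbs inequality for the weights \<open>x\<close> and \<open>z\<close> normalised to
  total mass 1, from \<open>ln u \<le> u - 1\<close> at the ratio of the normalised weights.\<close>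

lemma log_sum_le:
  fixes x z :: "'a \<Rightarrow> real"
  assumes fin: "finite A" and x: "\<And>a. a \<in> A \<Longrightarrow> 0 \<le> x a" and z: "\<And>a. a \<in> A \<Longrightarrow> 0 < z a"
  shows "(\<Sum>a\<in>A. x a * ln (z a)) \<le> (\<Sum>a\<in>A. x a * ln (x a)) + (\<Sum>a\<in>A. x a) * (ln (\<Sum>a\<in>A. z a) - ln (\<Sum>a\<in>A. x a))"
proof (cases "(\<Sum>a\<in>A. x a) = 0")
  case True
  then have "\<And>a. a \<in> A \<Longrightarrow> x a = 0"
    using fin x by (simp add: sum_nonneg_eq_0_iff)
  then show ?thesis by simp
next
  case False
  define s where "s = (\<Sum>a\<in>A. x a)"
  define w where "w = (\<Sum>a\<in>A. z a)"
  have s: "s > 0"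
    using False x by (simp add: s_def sum_nonneg less_le)
  have w: "w > 0"
    unfolding w_def using False fin z by (intro sum_pos) auto
  have "x a * ln (z a) - (x a * ln (x a) + x a * (ln w - ln s)) \<le> s * z a / w - x a" if a: "a \<in> A" for a
  proof (cases "x a = 0")
    case True
    then show ?thesis using s w z[OF a] by simp
  next
    case False
    then have xa: "x a > 0" using x[OF a] by simp
    have "ln (s * z a / (w * x a)) = ln s + ln (z a) - (ln w + ln (x a))"
      using s w xa z[OF a] by (simp add: ln_div ln_mult)
    then have "ln s + ln (z a) - (ln w + ln (x a)) \<le> s * z a / (w * x a) - 1"
      using ln_le_minus_one[of "s * z a / (w * x a)"] s w xa z[OF a] by simp
    then have "x a * (ln s + ln (z a) - (ln w + ln (x a))) \<le> x a * (s * z a / (w * x a) - 1)"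
      using xa by (intro mult_left_mono) auto
    also have "\<dots> = s * z a / w - x a"
      using xa w by (simp add: field_simps)
    finally show ?thesis by (simp add: algebra_simps)
  qed
  then have "(\<Sum>a\<in>A. x a * ln (z a) - (x a * ln (x a) + x a * (ln w - ln s))) \<le> (\<Sum>a\<in>A. s * z a / w - x a)"
    by (rule sum_mono)
  also have "\<dots> = 0"
    using w by (simp add: sum_subtractf sum_divide_distrib[symmetric] sum_distrib_left[symmetric] s_def[symmetric] w_def[symmetric])
  finally show ?thesis
    by (simp add: sum_subtractf sum.distrib sum_distrib_right[symmetric] s_def[symmetric] w_def[symmetric])
qed

text \<open>\<open>log_sum_le\<close> with \<open>z a = exp 1 + x a\<close>; the factor
  \<open>card A\<close> cancels in the difference of logarithms.\<close>

lemma mean_mult_ln_exp_plus_le: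
  fixes x :: "'a \<Rightarrow> real"
  assumes A: "finite A" "A \<noteq> {}" and x: "\<And>a. a \<in> A \<Longrightarrow> 0 \<le> x a"
  defines "V \<equiv> (\<Sum>a\<in>A. x a) / card A"
  shows "(\<Sum>a\<in>A. x a * ln (exp 1 + x a))
    \<le> ((\<Sum>a\<in>A. x a * ln (x a)) - card A * (V * ln V)) + card A * (V * ln (exp 1 + V))"
proof -
  let ?N = "real (card A)"
  have N: "?N > 0" using A by (simp add: card_gt_0_iff)
  have V0: "V \<ge> 0" using x by (simp add: V_def sum_nonneg)
  have sx: "(\<Sum>a\<in>A. x a) = ?N * V" using N by (simp add: V_def)
  have "(\<Sum>a\<in>A. exp 1 + x a) = ?N * (exp 1 + V)"
    by (simp add: sum.distrib sx distrib_left)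
  then have "(\<Sum>a\<in>A. x a * ln (exp 1 + x a)) \<le> (\<Sum>a\<in>A. x a * ln (x a)) + ?N * V * (ln (?N * (exp 1 + V)) - ln (?N * V))"
    using log_sum_le[OF A(1), where x=x and z="\<lambda>a. exp 1 + x a"] x unfolding sx by (simp add: add_pos_nonneg)
  also have "?N * V * (ln (?N * (exp 1 + V)) - ln (?N * V)) = ?N * V * (ln (exp 1 + V) - ln V)"
  proof (cases "V = 0")
    case False
    moreover have "exp 1 + V > 0" using V0 by (simp add: add_pos_nonneg)
    ultimately show ?thesis using V0 N by (simp add: ln_mult)
  qed simp
  finally show ?thesis by (simp add: algebra_simps)
qed

text \<open>In the constant, 16 is the entropy factor 8 times the 2 from averaging.
  \<open>6 * C\<^sup>2\<close> comes from \<open>V \<le> 3 * C\<^sup>2 * R\<close> and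
  \<open>ln (exp 1 + V) \<le> 2\<close>.\<close>

lemma mean_psi_le_one:
  fixes f :: "(nat \<Rightarrow> nat) \<Rightarrow> 'e::banach"
  assumes C: "martingale_type_2_bound C TYPE(nat \<Rightarrow> 'e) TYPE('e)" and n: "n \<ge> 2" and \<gamma>: "\<gamma> > 0"
    and le: "(16 + 6 * C\<^sup>2) * (ln (real n) / (real n - 1) * (total_energy n f / fact n)) \<le> \<gamma>\<^sup>2"
  shows "(\<Sum>\<pi>\<in>sym_group n. psi (norm (f \<pi> - lint (unif_sym n) f) / \<gamma>)) / fact n \<le> 1"
proof -
  let ?G = "sym_group n"
  define g where "g \<pi> = norm (f \<pi> - lint (unif_sym n) f) / \<gamma>" for \<pi>
  define R where "R = ln (real n) / (real n - 1) * (total_energy n f / fact n) / \<gamma>\<^sup>2"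
  define V where "V = (\<Sum>\<pi>\<in>?G. (g \<pi>)\<^sup>2) / fact n"
  have G: "finite ?G" "?G \<noteq> {}" "card ?G = fact n"
    using permutes_id[of "{1..n}"] card_permutations[of "{1..n}" n]
    by (auto simp only: finite_permutations finite_atLeastAtMost card_atLeastAtMost diff_Suc_1)
  have te: "total_energy n f \<ge> 0"
    by (simp add: total_energy_def sum_nonneg)
  have n1: "real n - 1 > 0" using n by simp
  have R0: "R \<ge> 0" using te n1 by (simp add: R_def)
  have MR: "(16 + 6 * C\<^sup>2) * R \<le> 1"
  proof -
    have "(16 + 6 * C\<^sup>2) * R = (16 + 6 * C\<^sup>2) * (ln (real n) / (real n - 1) * (total_energy n f / fact n)) / \<gamma>\<^sup>2"
      by (simp add: R_def)
    then show ?thesis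
      using le \<gamma> by (simp only: divide_le_eq_1_pos zero_less_power)
  qed
  have l2: "2 / 3 \<le> ln (real n)"
  proof -
    have "ln 2 \<le> ln (real n)" using n by simp
    then show ?thesis using ln2_ge_two_thirds by linarith
  qed
  have "fact n * V = (\<Sum>\<pi>\<in>?G. (g \<pi>)\<^sup>2)"
    by (simp add: V_def)
  also have "\<dots> = (\<Sum>\<pi>\<in>?G. (norm (f \<pi> - lint (unif_sym n) f))\<^sup>2) / \<gamma>\<^sup>2"
    by (simp add: g_def power_divide sum_divide_distrib)
  also have "\<dots> \<le> C\<^sup>2 * (2 / (real n - 1) * total_energy n f) / \<gamma>\<^sup>2"
    by (intro divide_right_mono poincare_total_energy[OF C n]) simp
  also have "\<dots> = (2 * C\<^sup>2) * (total_energy n f / (real n - 1) / \<gamma>\<^sup>2) * 1"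
    by simp
  \<comment> \<open>The variance bound has no logarithm; \<open>3 / 2 * ln n \<ge> 1\<close> inserts
    one so that it compares with \<open>R\<close>.\<close>
  also have "\<dots> \<le> (2 * C\<^sup>2) * (total_energy n f / (real n - 1) / \<gamma>\<^sup>2) * (3 / 2 * ln (real n))"
    using l2 te n1 by (intro mult_left_mono mult_nonneg_nonneg divide_nonneg_nonneg) auto
  also have "\<dots> = fact n * (3 * C\<^sup>2 * R)"
    by (simp add: R_def)
  finally have V: "V \<le> 3 * C\<^sup>2 * R" by (subst (asm) mult_le_cancel_left_pos) simp_all
  have V0: "V \<ge> 0" by (simp add: V_def sum_nonneg)
  have V1: "V \<le> 1" using V MR R0 zero_le_power2[of C] mult_nonneg_nonneg[OF zero_le_power2[of C] R0] by (simp add: algebra_simps)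
  have "exp 1 + V \<le> exp (2::real)"
  proof -
    have "(2::real) \<le> exp 1" using exp_ge_add_one_self[of 1] by simp
    then have "2 * exp 1 \<le> exp 1 * exp (1::real)" by (intro mult_right_mono) auto
    also have "\<dots> = exp 2" by (simp add: exp_add[symmetric])
    finally show ?thesis using V1 \<open>(2::real) \<le> exp 1\<close> by linarith
  qed
  then have lnV: "ln (exp 1 + V) \<le> 2"
    using V0 by (metis add_pos_nonneg exp_gt_zero ln_exp ln_le_cancel_iff)
  \<comment> \<open>The norm is 1-Lipschitz, so passing from \<open>f\<close> to the real function
    \<open>g\<close> does not raise the energy beyond the scaling by
    \<open>\<gamma>\<close>.\<close>
  have "total_energy n g \<le> total_energy n f / \<gamma>\<^sup>2"
    unfolding total_energy_def sum_divide_distrib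
  proof (intro sum_mono)
    fix \<tau> \<pi>
    have "\<bar>g \<pi> - g (\<tau> \<circ> \<pi>)\<bar> \<le> norm (f \<pi> - f (\<tau> \<circ> \<pi>)) / \<gamma>"
      unfolding g_def diff_divide_distrib[symmetric] abs_divide abs_of_pos[OF \<gamma>]
      using norm_triangle_ineq3[of "f \<pi> - lint (unif_sym n) f" "f (\<tau> \<circ> \<pi>) - lint (unif_sym n) f"] \<gamma>
      by (intro divide_right_mono) auto
    then show "(norm (g \<pi> - g (\<tau> \<circ> \<pi>)))\<^sup>2 \<le> (norm (f \<pi> - f (\<tau> \<circ> \<pi>)))\<^sup>2 / \<gamma>\<^sup>2"
      unfolding power_divide[symmetric] by (intro power_mono) auto
  qed
  then have "8 * ln (real n) * (2 / (real n - 1) * total_energy n g) \<le> 8 * ln (real n) * (2 / (real n - 1) * (total_energy n f / \<gamma>\<^sup>2))"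
    using n1 l2 by (intro mult_left_mono) auto
  also have "\<dots> = fact n * (16 * R)" by (simp add: R_def)
  finally have ent: "(\<Sum>\<pi>\<in>?G. (g \<pi>)\<^sup>2 * ln ((g \<pi>)\<^sup>2)) - fact n * (V * ln V) \<le> fact n * (16 * R)"
    using log_sobolev_total_energy[OF n, of g] by (simp only: V_def)
  have "(\<Sum>\<pi>\<in>?G. psi (g \<pi>)) \<le> fact n * (16 * R) + fact n * (V * ln (exp 1 + V))"
    using mean_mult_ln_exp_plus_le[OF G(1,2), of "\<lambda>\<pi>. (g \<pi>)\<^sup>2"] ent
    unfolding psi_def G(3) V_def of_nat_fact by simp
  also have "\<dots> \<le> fact n * (16 * R) + fact n * (3 * C\<^sup>2 * R * 2)"
  proof -
    have "V * ln (exp 1 + V) \<le> V * 2" using lnV V0 by (rule mult_left_mono)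
    also have "\<dots> \<le> 3 * C\<^sup>2 * R * 2" using V by (rule mult_right_mono) simp
    finally show ?thesis by simp
  qed
  also have "\<dots> = fact n * ((16 + 6 * C\<^sup>2) * R)" by (simp add: algebra_simps)
  also have "\<dots> \<le> fact n * 1" using MR by (intro mult_left_mono) auto
  finally show ?thesis by (simp add: g_def)
qed

theorem theorem3:
  assumes "martingale_type_2 TYPE('e::banach)"
  shows "\<exists>M>0. \<forall>n\<ge>2. \<forall>f :: (nat \<Rightarrow> nat) \<Rightarrow> 'e.
    (L2logL_norm n (\<lambda>\<pi>. f \<pi> - lint (unif_sym n) f))\<^sup>2
      \<le> M * ln (real n) / (real n - 1) *
         (\<Sum>\<tau>\<in>transpositions n. \<integral>\<pi>. (norm (f \<pi> - f (\<tau> \<circ> \<pi>)))\<^sup>2 \<partial>unif_sym n)"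
proof -
  obtain C where C: "martingale_type_2_bound C TYPE(nat \<Rightarrow> 'e) TYPE('e)"
    using assms by (auto simp: martingale_type_2_def)
  define M where "M = 16 + 6 * C\<^sup>2"
  have "(L2logL_norm n (\<lambda>\<pi>. f \<pi> - lint (unif_sym n) f))\<^sup>2
      \<le> M * ln (real n) / (real n - 1) *
         (\<Sum>\<tau>\<in>transpositions n. \<integral>\<pi>. (norm (f \<pi> - f (\<tau> \<circ> \<pi>)))\<^sup>2 \<partial>unif_sym n)"
    if n: "n \<ge> 2" for n and f :: "(nat \<Rightarrow> nat) \<Rightarrow> 'e"
  proof -
    define R where "R = ln (real n) / (real n - 1) * (total_energy n f / fact n)"
    define S where "S = {\<gamma>. \<gamma> > 0 \<and> (\<integral>\<pi>. psi (norm (f \<pi> - lint (unif_sym n) f) / \<gamma>) \<partial>unif_sym n) \<le> 1}"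
    have int: "(\<integral>\<pi>. h \<pi> \<partial>unif_sym n) = (\<Sum>\<pi>\<in>sym_group n. h \<pi>) / fact n" for h :: "(nat \<Rightarrow> nat) \<Rightarrow> real"
      unfolding unif_sym_def
      by (subst integral_uniform_count_measure) (simp_all add: finite_permutations card_permutations[OF refl])
    have "R \<ge> 0"
      using n by (simp add: R_def total_energy_def sum_nonneg)
    then have MR: "M * R \<ge> 0" by (simp add: M_def)
    have bdd: "bdd_below S" by (auto simp: S_def intro!: bdd_belowI[of _ 0])
    \<comment> \<open>Admissible \<open>\<gamma>\<close> must be positive and \<open>R\<close> may
      be 0, hence the extra \<open>\<epsilon>\<close>.\<close>
    have mem: "sqrt (M * R) + \<epsilon> \<in> S" if "\<epsilon> > 0" for \<epsilon>
    proof -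
      have pos: "sqrt (M * R) + \<epsilon> > 0" using that MR by (simp add: add_nonneg_pos)
      have "M * R = (sqrt (M * R))\<^sup>2" using MR by simp
      also have "\<dots> \<le> (sqrt (M * R) + \<epsilon>)\<^sup>2" using that MR by (intro power_mono) auto
      finally show ?thesis
        using mean_psi_le_one[OF C n pos, of f] pos by (simp add: S_def int M_def R_def)
    qed
    have "Inf S \<le> sqrt (M * R)"
      by (rule field_le_epsilon) (intro cInf_lower bdd mem)
    \<comment> \<open>Squaring needs a nonnegative infimum; \<open>mem[of 1]\<close> shows that
      \<open>S\<close> is nonempty.\<close>
    moreover have "0 \<le> Inf S"
      using mem[of 1] by (intro cInf_greatest) (auto simp: S_def)
    ultimately have "(Inf S)\<^sup>2 \<le> (sqrt (M * R))\<^sup>2"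
      by (rule power_mono)
    also have "\<dots> = M * R" using MR by simp
    also have "\<dots> = M * ln (real n) / (real n - 1) *
         (\<Sum>\<tau>\<in>transpositions n. \<integral>\<pi>. (norm (f \<pi> - f (\<tau> \<circ> \<pi>)))\<^sup>2 \<partial>unif_sym n)"
      by (simp add: R_def int total_energy_def sum_divide_distrib[symmetric])
    finally show ?thesis
      by (simp add: L2logL_norm_def S_def)
  qed
  moreover have "M > 0" by (simp add: M_def add_pos_nonneg)
  ultimately show ?thesis by blast
qed

end
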